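(* Let $X$ be a complex Banach space, $0<\alpha<1$, $1\le q\le\infty$, let $A$ satisfy Condition (A), and fix $\mu$ with $1-\frac{1}{q\alpha}<\mu<1$. Then for every $a\in\mathcal{D}((-A)^{\mu})$, $$G(\cdot)a-a\in W_{\alpha,q}(0,T;X)\cap L^{\infty}(0,\infty;X)\quad\text{for all }T>0,$$ and $$\partial_t^{\alpha}(G(t)a-a)=AG(t)a\quad\text{for }0<t<T.$$
   Context: Condition (A) on a linear operator $A:\mathcal{D}(A)\subset X\to X$: (i) $A$ is closed and densely defined; (ii) there is $\vartheta\in(\pi/2,\pi)$ with $\Sigma_{\vartheta}:=\{z\in\mathbb{C}\setminus\{0\}:|\arg z|<\vartheta\}\subset\rho(A)$; (iii) for every $\epsilon\in(0,\vartheta)$ there is $C_\epsilon>0$ with $\|(\lambda-A)^{-1}\|\le C_\epsilon/|\lambda|$ for $\lambda\in\Sigma_{\vartheta-\epsilon}$; (iv) $0\in\rho(A)$. $(-A)^{\mu}$ is the standard fractional power of $-A$. For $\beta>0$, $J^{\beta}v(t)=\frac{1}{\Gamma(\beta)}\int_0^t(t-s)^{\beta-1}v(s)\,ds$ on $L^q(0,T;X)$; $W_{\beta,q}(0,T;X):=J^{\beta}L^q(0,T;X)$ and $\partial_t^{\beta}:=(J^{\beta})^{-1}:W_{\beta,q}(0,T;X)\to L^q(0,T;X)$. Principal branches of powers are used. For $t>0$, $G(t)a:=\frac{1}{2\pi i}\int_{\Gamma}e^{\lambda t}\lambda^{\alpha-1}(\lambda^{\alpha}-A)^{-1}a\,d\lambda$,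 with $\Gamma=\{\rho e^{-i\vartheta}:\rho>1/t\}\cup\{t^{-1}e^{i\theta}:-\vartheta\le\theta\le\vartheta\}\cup\{\rho e^{i\vartheta}:\rho>1/t\}$ oriented from $\infty e^{-i\vartheta}$ to $\infty e^{i\vartheta}$. *)

theory Defs
  imports "HOL-Analysis.Analysis"
begin

class cbanach = banach +
  fixes cscale :: "complex \<Rightarrow> 'a \<Rightarrow> 'a"  (infixr \<open>*\<^sub>C\<close> 75)
  assumes cscale_add_right: "c *\<^sub>C (x + y) = c *\<^sub>C x + c *\<^sub>C y"
    and cscale_add_left: "(c + d) *\<^sub>C x = c *\<^sub>C x + d *\<^sub>C x"
    and cscale_cscale: "c *\<^sub>C (d *\<^sub>C x) = (c * d) *\<^sub>C x"
    and cscale_one: "1 *\<^sub>C x = x"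
    and scaleR_cscale: "r *\<^sub>R x = complex_of_real r *\<^sub>C x"
    and norm_cscale: "norm (c *\<^sub>C x) = cmod c * norm x"

definition csubspace :: "'a::cbanach set \<Rightarrow> bool" where
  "csubspace D \<longleftrightarrow> 0 \<in> D \<and> (\<forall>x\<in>D. \<forall>y\<in>D. x + y \<in> D) \<and> (\<forall>c. \<forall>x\<in>D. c *\<^sub>C x \<in> D)"

definition lin_op :: "('a::cbanach \<Rightarrow> 'a) \<Rightarrow> 'a set \<Rightarrow> bool" where
  "lin_op A D \<longleftrightarrow> csubspace D \<and> (\<forall>x\<in>D. \<forall>y\<in>D. A (x + y) = A x + A y)
     \<and> (\<forall>c. \<forall>x\<in>D. A (c *\<^sub>C x) = c *\<^sub>C A x)"

definition closed_op :: "('a::cbanach \<Rightarrow> 'a) \<Rightarrow> 'a set \<Rightarrow> bool" where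
  "closed_op A D \<longleftrightarrow> closed {(x, A x) | x. x \<in> D}"

definition densely_defined :: "'a::cbanach set \<Rightarrow> bool" where
  "densely_defined D \<longleftrightarrow> closure D = UNIV"

definition is_resolvent :: "('a::cbanach \<Rightarrow> 'a) \<Rightarrow> 'a set \<Rightarrow> complex \<Rightarrow> ('a \<Rightarrow> 'a) \<Rightarrow> bool" where
  "is_resolvent A D l R \<longleftrightarrow> bounded_linear R \<and>
     (\<forall>x. R x \<in> D \<and> l *\<^sub>C R x - A (R x) = x) \<and> (\<forall>y\<in>D. R (l *\<^sub>C y - A y) = y)"

definition resolvent_set :: "('a::cbanach \<Rightarrow> 'a) \<Rightarrow> 'a set \<Rightarrow> complex set" where
  "resolvent_set A D = {l. \<exists>R. is_resolvent A D l R}"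

text \<open>\<open>resolvent A D l = (l - A)\<^sup>-\<^sup>1\<close> (meaningful for \<open>l \<in> resolvent_set A D\<close>).\<close>
definition resolvent :: "('a::cbanach \<Rightarrow> 'a) \<Rightarrow> 'a set \<Rightarrow> complex \<Rightarrow> 'a \<Rightarrow> 'a" where
  "resolvent A D l = (THE R. is_resolvent A D l R)"

definition sector :: "real \<Rightarrow> complex set" where
  "sector th = {z. z \<noteq> 0 \<and> \<bar>Arg z\<bar> < th}"

text \<open>Condition (A), with the angle \<open>\<vartheta>\<close> made explicit (it is used in the contour of \<open>G\<close>).\<close>
definition condA :: "('a::cbanach \<Rightarrow> 'a) \<Rightarrow> 'a set \<Rightarrow> real \<Rightarrow> bool" where
  "condA A D th \<longleftrightarrow>
     lin_op A D \<and> closed_op A D \<and> densely_defined D \<and>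
     pi / 2 < th \<and> th < pi \<and> sector th \<subseteq> resolvent_set A D \<and>
     (\<forall>e. 0 < e \<and> e < th \<longrightarrow>
        (\<exists>C>0. \<forall>l\<in>sector (th - e). onorm (resolvent A D l) \<le> C / cmod l)) \<and>
     0 \<in> resolvent_set A D"

text \<open>Balakrishnan formula: for \<open>0 < \<mu> < 1\<close>,
  \<open>(-A)\<^sup>-\<^sup>\<mu> x = (sin (\<pi>\<mu>) / \<pi>) \<integral>\<^sub>0\<^sup>\<infinity> s\<^sup>-\<^sup>\<mu> (s - A)\<^sup>-\<^sup>1 x ds\<close>.\<close>
definition neg_frac_pow_01 :: "('a::cbanach \<Rightarrow> 'a) \<Rightarrow> 'a set \<Rightarrow> real \<Rightarrow> 'a \<Rightarrow> 'a" where
  "neg_frac_pow_01 A D m x =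
     (sin (pi * m) / pi) *\<^sub>R integral {0<..} (\<lambda>s::real. (s powr (- m)) *\<^sub>R resolvent A D (complex_of_real s) x)"

text \<open>For \<open>\<mu> > 0\<close>: \<open>(-A)\<^sup>-\<^sup>\<mu> = (-A)\<^sup>-\<^sup>r ((-A)\<^sup>-\<^sup>1)\<^sup>k\<close> with \<open>k = \<lfloor>\<mu>\<rfloor>\<close>, \<open>r = \<mu> - k\<close>;
  note \<open>(-A)\<^sup>-\<^sup>1 = (0 - A)\<^sup>-\<^sup>1 = resolvent A D 0\<close>.\<close>
definition neg_frac_pow :: "('a::cbanach \<Rightarrow> 'a) \<Rightarrow> 'a set \<Rightarrow> real \<Rightarrow> 'a \<Rightarrow> 'a" where
  "neg_frac_pow A D m =
     (let k = nat \<lfloor>m\<rfloor>; r = m - real k in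
        (if r = 0 then id else neg_frac_pow_01 A D r) \<circ> (resolvent A D 0 ^^ k))"

text \<open>Domain of \<open>(-A)\<^sup>\<mu>\<close>: all of \<open>X\<close> if \<open>\<mu> \<le> 0\<close> (bounded operator), and the range of
  \<open>(-A)\<^sup>-\<^sup>\<mu>\<close> if \<open>\<mu> > 0\<close> (since \<open>(-A)\<^sup>\<mu> = ((-A)\<^sup>-\<^sup>\<mu>)\<^sup>-\<^sup>1\<close>).\<close>
definition frac_pow_dom :: "('a::cbanach \<Rightarrow> 'a) \<Rightarrow> 'a set \<Rightarrow> real \<Rightarrow> 'a set" where
  "frac_pow_dom A D m = (if m \<le> 0 then UNIV else range (neg_frac_pow A D m))"

definition strongly_measurable_on :: "real set \<Rightarrow> (real \<Rightarrow> 'a::cbanach) \<Rightarrow> bool" where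
  "strongly_measurable_on S f \<longleftrightarrow>
     (\<exists>g :: nat \<Rightarrow> real \<Rightarrow> 'a.
        (\<forall>n. finite (range (g n)) \<and> (\<forall>y. g n -` {y} \<in> sets lebesgue)) \<and>
        (AE t in lebesgue. t \<in> S \<longrightarrow> (\<lambda>n. g n t) \<longlonglongrightarrow> f t))"

definition Lq :: "ereal \<Rightarrow> real set \<Rightarrow> (real \<Rightarrow> 'a::cbanach) set" where
  "Lq q S = {f. strongly_measurable_on S f \<and>
     (if q = \<infinity> then (\<exists>M. AE t in lebesgue. t \<in> S \<longrightarrow> norm (f t) \<le> M)
      else (\<integral>\<^sup>+ t. indicator S t * ennreal (norm (f t) powr real_of_ereal q) \<partial>lebesgue) < \<infinity>)}"

definition RL_int :: "real \<Rightarrow> (real \<Rightarrow> 'a::cbanach) \<Rightarrow> real \<Rightarrow> 'a" where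
  "RL_int b v t = (1 / Gamma b) *\<^sub>R integral {0..t} (\<lambda>s. ((t - s) powr (b - 1)) *\<^sub>R v s)"

text \<open>\<open>v \<in> L\<^sup>q(0,T;X)\<close> and \<open>u = J\<^sup>\<beta> v\<close> (a.e. on \<open>(0,T)\<close>); i.e. \<open>u \<in> W\<^sub>\<beta>\<^sub>,\<^sub>q(0,T;X)\<close> and
  \<open>\<partial>\<^sub>t\<^sup>\<beta> u = v\<close>, since \<open>\<partial>\<^sub>t\<^sup>\<beta> = (J\<^sup>\<beta>)\<^sup>-\<^sup>1\<close>.\<close>
definition has_frac_deriv :: "real \<Rightarrow> ereal \<Rightarrow> real \<Rightarrow> (real \<Rightarrow> 'a::cbanach) \<Rightarrow> (real \<Rightarrow> 'a) \<Rightarrow> bool" where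
  "has_frac_deriv b q T u v \<longleftrightarrow> v \<in> Lq q {0<..<T} \<and>
     (AE t in lebesgue. t \<in> {0<..<T} \<longrightarrow> u t = RL_int b v t)"

definition W_space :: "real \<Rightarrow> ereal \<Rightarrow> real \<Rightarrow> (real \<Rightarrow> 'a::cbanach) set" where
  "W_space b q T = {u. \<exists>v. has_frac_deriv b q T u v}"

definition G_integrand :: "('a::cbanach \<Rightarrow> 'a) \<Rightarrow> 'a set \<Rightarrow> real \<Rightarrow> real \<Rightarrow> 'a \<Rightarrow> complex \<Rightarrow> 'a" where
  "G_integrand A D al t a l =
     (exp (l * complex_of_real t) * l powr (complex_of_real al - 1)) *\<^sub>C
       resolvent A D (l powr complex_of_real al) a"

text \<open>\<open>G(t)a = (2\<pi>i)\<^sup>-\<^sup>1 \<integral>\<^sub>\<Gamma> \<dots> d\<lambda>\<close>, the contour \<open>\<Gamma>\<close> written out with its parametrisation: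
  incoming lower ray \<open>\<lambda> = \<rho>e\<^sup>-\<^sup>i\<^sup>\<vartheta>\<close> (\<open>\<rho>\<close> from \<open>\<infinity>\<close> to \<open>1/t\<close>), arc \<open>\<lambda> = t\<^sup>-\<^sup>1e\<^sup>i\<^sup>\<theta>\<close>
  (\<open>\<theta>\<close> from \<open>-\<vartheta>\<close> to \<open>\<vartheta>\<close>), outgoing upper ray \<open>\<lambda> = \<rho>e\<^sup>i\<^sup>\<vartheta>\<close> (\<open>\<rho>\<close> from \<open>1/t\<close> to \<open>\<infinity>\<close>).\<close>
definition Gop :: "('a::cbanach \<Rightarrow> 'a) \<Rightarrow> 'a set \<Rightarrow> real \<Rightarrow> real \<Rightarrow> real \<Rightarrow> 'a \<Rightarrow> 'a" where
  "Gop A D al th t a =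
     (1 / (2 * complex_of_real pi * \<i>)) *\<^sub>C
       ( integral {1 / t..} (\<lambda>r. cis th *\<^sub>C G_integrand A D al t a (complex_of_real r * cis th))
       - integral {1 / t..} (\<lambda>r. cis (- th) *\<^sub>C G_integrand A D al t a (complex_of_real r * cis (- th)))
       + integral {- th..th} (\<lambda>s. (\<i> * cis s / complex_of_real t) *\<^sub>C
                                       G_integrand A D al t a (cis s / complex_of_real t)))"

end

theory Submission
  imports Defs
begin

text \<open>Every integral over the Hankel contour is a limit of integrals over arcs of radius \<open>N\<close>, because
  the arc integral has the difference of the two ray integrands as its radial derivative. Subtracting
  \<open>a = (2\<pi>i)\<^sup>-\<^sup>1 \<integral> e\<^sup>\<lambda>\<^sup>t \<lambda>\<^sup>-\<^sup>1 a d\<lambda>\<close> shows that \<open>G(t)a - a\<close> and \<open>A G(t)a\<close> are the contour integrals with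
  symbols \<open>w = \<lambda>\<^sup>-\<^sup>1 A (\<lambda>\<^sup>\<alpha> - A)\<^sup>-\<^sup>1 a\<close> and \<open>\<lambda>\<^sup>\<alpha> w\<close>. The fractional integral of \<open>s \<mapsto> e\<^sup>\<lambda>\<^sup>s\<close> differs
  from \<open>\<lambda>\<^sup>-\<^sup>\<alpha> e\<^sup>\<lambda>\<^sup>t\<close> by \<open>O(1/|\<lambda>|)\<close> on the whole sector, an error which the arcs do not see as their
  radius grows; hence \<open>J\<^sup>\<alpha> A G(\<cdot>)a = G(\<cdot>)a - a\<close>. Integrability in \<open>L\<^sup>q\<close> comes from
  \<open>A (\<lambda> - A)\<^sup>-\<^sup>1 a = O(|\<lambda>|\<^sup>-\<^sup>\<mu>)\<close> for \<open>a\<close> in the domain of \<open>(-A)\<^sup>\<mu>\<close>. Since \<open>X\<close> need not be separable, all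
  vector-valued integrals are Henstock-Kurzweil integrals.\<close>

text \<open>Arcs are useful because their angle runs over a compact interval: exchanging the arc
  with the time integral, differentiating under it and passing to uniform limits involve continuous
  integrands only, and two improper integrals never have to be interchanged. The price is uniform
  control of the two discarded ray tails. For a symbol of size |\<lambda>|^p they are at most a
  constant times \<open>s powr (- b) * N powr (p - b + 1)\<close>, for every \<open>b\<close> in
  [0,1] above \<open>p + 1\<close>. At a fixed time \<open>b = 1\<close> serves; under the
  fractional integral the singularity at \<open>s = 0\<close> forces \<open>b < 1\<close>, whence
  \<open>b = (1 + al) / 2\<close> for \<open>p = al - 1\<close>. The unbounded operator A is never
  moved through an integral. Instead G(t)a is recognised as the image of a contour integral v(t)
  under the bounded inverse of A, which yields both G(t)a in \<open>D\<close> and A G(t)a = v(t).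
  The lower bound on \<mu> enters once: v(t) = O(t^(-\<alpha>(1-\<mu>))), and q \<alpha> (1-\<mu>) <
  1 is what makes the q-th power integrable at 0.\<close>

section \<open>Complex scalars under the integral\<close>

lemma bounded_bilinear_cscale: "bounded_bilinear ((*\<^sub>C) :: complex \<Rightarrow> 'a::cbanach \<Rightarrow> 'a)"
proof
  show "\<exists>K. \<forall>a (b::'a). norm (a *\<^sub>C b) \<le> norm a * norm b * K"
    by (rule exI[of _ 1]) (simp add: norm_cscale)
next
  fix r c and x :: 'a
  show "c *\<^sub>C (r *\<^sub>R x) = r *\<^sub>R (c *\<^sub>C x)"
    by (simp add: scaleR_cscale cscale_cscale mult.commute)
  show "(r *\<^sub>R c) *\<^sub>C x = r *\<^sub>R (c *\<^sub>C x)"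
    by (simp add: scaleR_cscale cscale_cscale scaleR_conv_of_real)
qed (simp_all add: cscale_add_left cscale_add_right)

interpretation cscale: bounded_bilinear "(*\<^sub>C) :: complex \<Rightarrow> 'a::cbanach \<Rightarrow> 'a"
  by (rule bounded_bilinear_cscale)

lemma continuous_on_cscale [continuous_intros]:
  fixes g :: "'b::topological_space \<Rightarrow> 'a::cbanach"
  shows "continuous_on S f \<Longrightarrow> continuous_on S g \<Longrightarrow> continuous_on S (\<lambda>x. f x *\<^sub>C g x)"
  by (rule cscale.continuous_on)

text \<open>No integrability is assumed: a nonzero scalar preserves non-integrability, and then both
  sides are the default value 0.\<close>

lemma integral_cscale_right:
  fixes f :: "'n::euclidean_space \<Rightarrow> 'a::cbanach"
  shows "integral S (\<lambda>x. c *\<^sub>C f x) = c *\<^sub>C integral S f"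
proof (cases "f integrable_on S")
  case True
  then show ?thesis
    using integral_linear[OF True cscale.bounded_linear_right[of c]] by (simp add: o_def)
next
  case False
  show ?thesis
  proof (cases "c = 0")
    case False
    have "\<not> (\<lambda>x. c *\<^sub>C f x) integrable_on S"
    proof
      assume "(\<lambda>x. c *\<^sub>C f x) integrable_on S"
      from integrable_linear[OF this cscale.bounded_linear_right[of "inverse c"]]
      have "f integrable_on S" using False by (simp add: o_def cscale_cscale cscale_one)
      with \<open>\<not> f integrable_on S\<close> show False ..
    qed
    with \<open>\<not> f integrable_on S\<close> show ?thesis
      by (simp add: not_integrable_integral cscale.zero_right)
  qed (simp add: cscale.zero_left)
qed

section \<open>Integrability by domination, and strong measurability\<close>

text \<open>A vector-valued form of the straddling criterion. On fine divisions the Riemann sums of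
  \<open>f\<close> differ from those of \<open>g\<close> by at most a Riemann sum of
  \<open>h\<close>, which is small, so the Cauchy criterion applies.\<close>

lemma integrable_straddle_normed:
  fixes f :: "real \<Rightarrow> 'a::banach"
  assumes "\<And>e. e > 0 \<Longrightarrow> \<exists>g h. g integrable_on {a..b} \<and> h integrable_on {a..b} \<and>
    (\<forall>x\<in>{a..b}. norm (f x - g x) \<le> h x) \<and> integral {a..b} h < (e::real)"
  shows "f integrable_on {a..b}"
proof -
  have "f integrable_on cbox a b"
    unfolding integrable_Cauchy
  proof (intro allI impI)
    fix e :: real assume "e > 0"
    \<comment> \<open>The error budget: a Riemann sum of \<open>h\<close> is below e/8 + e/8 and one
      of \<open>g\<close> is e/8-close to its integral. So each division costs 3e/8 < e/2, and two
      divisions cost less than \<open>e\<close>.\<close>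
    then obtain g h where g: "g integrable_on cbox a b" and h: "h integrable_on cbox a b"
      and gh: "\<And>x. x \<in> cbox a b \<Longrightarrow> norm (f x - g x) \<le> h x" and he: "integral (cbox a b) h < e / 8"
      using assms[of "e/8"] by auto
    have e8: "e / 8 > 0" using \<open>e > 0\<close> by simp
    obtain d1 where d1: "gauge d1" "\<And>D. D tagged_division_of cbox a b \<Longrightarrow> d1 fine D \<Longrightarrow>
        norm ((\<Sum>(x,K)\<in>D. measure lborel K *\<^sub>R g x) - integral (cbox a b) g) < e / 8"
      using has_integralD[OF integrable_integral[OF g] e8] by blast
    obtain d2 where d2: "gauge d2" "\<And>D. D tagged_division_of cbox a b \<Longrightarrow> d2 fine D \<Longrightarrow>
        norm ((\<Sum>(x,K)\<in>D. measure lborel K *\<^sub>R h x) - integral (cbox a b) h) < e / 8"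
      using has_integralD[OF integrable_integral[OF h] e8] by blast
    have key: "norm ((\<Sum>(x,K)\<in>D. measure lborel K *\<^sub>R f x) - integral (cbox a b) g) < e / 2"
      if D: "D tagged_division_of cbox a b" "d1 fine D" "d2 fine D" for D
    proof -
      have "norm ((\<Sum>(x,K)\<in>D. measure lborel K *\<^sub>R f x) - (\<Sum>(x,K)\<in>D. measure lborel K *\<^sub>R g x))
          \<le> (\<Sum>(x,K)\<in>D. measure lborel K *\<^sub>R h x)"
        unfolding sum_subtractf[symmetric]
      proof (rule sum_norm_le, clarify)
        fix x K assume "(x, K) \<in> D"
        then have "x \<in> cbox a b" using tagged_division_ofD(2,3)[OF D(1)] by blast
        then show "norm (measure lborel K *\<^sub>R f x - measure lborel K *\<^sub>R g x) \<le> measure lborel K *\<^sub>R h x"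
          using gh[of x] by (simp add: mult_left_mono flip: scaleR_diff_right)
      qed
      also have "\<dots> < e / 8 + e / 8"
        using d2(2)[OF D(1,3)] he unfolding real_norm_def by linarith
      finally have 1: "norm ((\<Sum>(x,K)\<in>D. measure lborel K *\<^sub>R f x) - (\<Sum>(x,K)\<in>D. measure lborel K *\<^sub>R g x)) < e / 8 + e / 8" .
      from norm_diff_triangle_less[OF 1 d1(2)[OF D(1,2)]] \<open>e > 0\<close> show ?thesis
        by simp
    qed
    show "\<exists>\<gamma>. gauge \<gamma> \<and> (\<forall>D1 D2. D1 tagged_division_of (cbox a b) \<and> \<gamma> fine D1 \<and>
            D2 tagged_division_of (cbox a b) \<and> \<gamma> fine D2 \<longrightarrow>
            norm ((\<Sum>(x,K)\<in>D1. measure lborel K *\<^sub>R f x) - (\<Sum>(x,K)\<in>D2. measure lborel K *\<^sub>R f x)) < e)"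
    proof (intro exI conjI allI impI)
      show "gauge (\<lambda>x. d1 x \<inter> d2 x)" using d1(1) d2(1) by (rule gauge_Int)
      fix D1 D2 assume "D1 tagged_division_of (cbox a b) \<and> (\<lambda>x. d1 x \<inter> d2 x) fine D1 \<and>
            D2 tagged_division_of (cbox a b) \<and> (\<lambda>x. d1 x \<inter> d2 x) fine D2"
      then have "D1 tagged_division_of cbox a b" "d1 fine D1" "d2 fine D1"
          "D2 tagged_division_of cbox a b" "d1 fine D2" "d2 fine D2"
        by (auto simp: fine_Int)
      from norm_diff_triangle_less[OF key[OF this(1-3)] key[OF this(4-6), unfolded norm_minus_commute[of _ "integral _ _"]]]
      show "norm ((\<Sum>(x,K)\<in>D1. measure lborel K *\<^sub>R f x) - (\<Sum>(x,K)\<in>D2. measure lborel K *\<^sub>R f x)) < e"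
        by simp
    qed
  qed
  then show ?thesis by simp
qed

text \<open>Serves integrands that may blow up at both ends. Cutting \<open>f\<close> off near the
  ends leaves a continuous function, and the error is dominated by \<open>g\<close> on two short end
  pieces, where the indefinite integral of \<open>g\<close> varies little.\<close>

lemma integrable_on_dominated_continuous:
  fixes f :: "real \<Rightarrow> 'a::banach"
  assumes f: "continuous_on {a<..<b} f" and g: "g integrable_on {a..b}"
    and fg: "\<And>x. x \<in> {a<..<b} \<Longrightarrow> norm (f x) \<le> g x"
  shows "f integrable_on {a..b}"
proof (cases "a < b")
  case True
  \<comment> \<open>Zeroing the end points makes the domination valid everywhere; the hypothesis
    says nothing about \<open>a\<close> and \<open>b\<close> themselves.\<close>
  define f0 where "f0 = (\<lambda>x. if x \<in> {a<..<b} then f x else 0)"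
  define g0 where "g0 = (\<lambda>x. if x \<in> {a<..<b} then g x else 0)"
  have g0: "g0 integrable_on {a..b}"
    by (rule integrable_spike[OF g, of "{a,b}"]) (auto simp: g0_def)
  have bnd: "norm (f0 x) \<le> g0 x" for x using fg by (auto simp: f0_def g0_def)
  have "f0 integrable_on {a..b}"
  proof (rule integrable_straddle_normed)
    fix e :: real assume e: "e > 0"
    have "continuous_on {a..b} (\<lambda>x. integral {a..x} g0)"
      by (rule indefinite_integral_continuous_1[OF g0])
    then have "uniformly_continuous_on {a..b} (\<lambda>x. integral {a..x} g0)"
      by (rule compact_uniformly_continuous) simp
    with e obtain d where d: "d > 0" "\<And>x y. x \<in> {a..b} \<Longrightarrow> y \<in> {a..b} \<Longrightarrow> dist x y < d \<Longrightarrow>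
       dist (integral {a..x} g0) (integral {a..y} g0) < e / 2"
      unfolding uniformly_continuous_on_def by (meson half_gt_zero)
    \<comment> \<open>A quarter keeps the end pieces shorter than \<open>d\<close> and the middle
      interval nondegenerate.\<close>
    define m where "m = min d (b - a) / 4"
    have "m > 0" "m \<le> d / 4" "m \<le> (b - a) / 4" using True d(1) by (auto simp: m_def)
    then have m: "m > 0" "m < d" "a + m < b - m" "m < b - a" using True d(1) by (simp_all add: field_simps)
    let ?c = "a + m" and ?c' = "b - m"
    let ?F = "\<lambda>x. if x \<in> {?c..?c'} then f0 x else 0"
    let ?H = "\<lambda>x. if x \<in> {?c..?c'} then 0 else g0 x"
    have F: "?F integrable_on {a..b}"
    proof -
      have "continuous_on {?c..?c'} f0"
        by (rule continuous_on_eq[OF continuous_on_subset[OF f]]) (use m in \<open>auto simp: f0_def\<close>)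
      then have "f0 integrable_on {?c..?c'}" by (rule integrable_continuous_interval)
      then have "f0 integrable_on {?c..?c'} \<inter> {a..b}"
        using m by (simp add: Int_absorb2)
      then show ?thesis by (simp only: integrable_restrict_Int)
    qed
    have gs: "g0 integrable_on {x..y}" if "a \<le> x" "y \<le> b" for x y
      by (rule integrable_subinterval_real[OF g0]) (use that in auto)
    have "((\<lambda>x. ?H x) has_integral (integral {a..?c} g0 + 0 + integral {?c'..b} g0)) {a..b}"
    proof (rule has_integral_combine[of a ?c' b], goal_cases)
      case 3
      show ?case
      proof (rule has_integral_combine[of a ?c ?c'], goal_cases)
        case 3
        show ?case
          by (rule has_integral_spike_finite[of "{?c}" _ _ g0])
             (use gs[of a ?c] m in \<open>auto intro: integrable_integral\<close>)
      next
        case 4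
        show ?case by (rule has_integral_is_0) auto
      qed (use m in auto)
    next
      case 4
      show ?case
        by (rule has_integral_spike_finite[of "{?c'}" _ _ g0])
             (use gs[of ?c' b] m in \<open>auto intro: integrable_integral\<close>)
    qed (use m in auto)
    moreover have "integral {a..?c} g0 < e / 2"
      using d(2)[of ?c a] m by (auto simp: dist_real_def)
    moreover have "integral {?c'..b} g0 < e / 2"
    proof -
      have "integral {a..?c'} g0 + integral {?c'..b} g0 = integral {a..b} g0"
        by (rule Henstock_Kurzweil_Integration.integral_combine) (use m g0 in auto)
      moreover have "\<bar>integral {a..b} g0 - integral {a..?c'} g0\<bar> < e / 2"
        using d(2)[of b ?c'] m by (auto simp: dist_real_def)
      ultimately show ?thesis by linarith
    qed
    ultimately have "?H integrable_on {a..b} \<and> integral {a..b} ?H < e"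
      by (auto simp: has_integral_iff)
    moreover have "\<forall>x\<in>{a..b}. norm (f0 x - ?F x) \<le> ?H x" using bnd by auto
    ultimately show "\<exists>g h. g integrable_on {a..b} \<and> h integrable_on {a..b} \<and>
      (\<forall>x\<in>{a..b}. norm (f0 x - g x) \<le> h x) \<and> integral {a..b} h < e"
      using F by blast
  qed
  then show ?thesis
    by (rule integrable_spike[of f0 _ "{a,b}"]) (auto simp: f0_def)
next
  case False
  then show ?thesis
    using integrable_on_refl[of f a] by (cases "a = b") (auto simp: integrable_on_empty)
qed

lemma integrable_on_ray_dominated:
  fixes f :: "real \<Rightarrow> 'a::banach"
  assumes f: "continuous_on {r..} f" and g: "g integrable_on {r..}"
    and fg: "\<And>x. x \<ge> r \<Longrightarrow> norm (f x) \<le> g x"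
  shows "f integrable_on {r..}"
proof (rule integrable_on_all_intervals_integrable_bound[OF _ _ g])
  fix a b :: real
  have "f integrable_on {max a r..b}"
    by (rule integrable_continuous_interval) (rule continuous_on_subset[OF f], auto)
  moreover have "{r..} \<inter> cbox a b = {max a r..b}" by auto
  ultimately show "(\<lambda>x. if x \<in> {r..} then f x else 0) integrable_on cbox a b"
    by (simp only: integrable_restrict_Int)
qed (use fg in auto)

text \<open>Simple functions are obtained by sampling \<open>f\<close> at the grid point of mesh
  1/(n+1) to the left of \<open>t\<close>; cutting off at |t| \<le> n leaves finitely many values.
  Grid points outside \<open>S\<close> get the value 0, which does not disturb the limit: since
  \<open>S\<close> is open, the grid points for a fixed \<open>t\<close> in \<open>S\<close>
  eventually lie in \<open>S\<close>.\<close>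

lemma strongly_measurable_on_continuous:
  fixes f :: "real \<Rightarrow> 'a::cbanach"
  assumes S: "open S" and f: "continuous_on S f"
  shows "strongly_measurable_on S f"
proof -
  define p where "p n t = real_of_int \<lfloor>t * real (Suc n)\<rfloor> / real (Suc n)" for n t
  define g where "g n t = (if \<bar>t\<bar> \<le> real n \<and> p n t \<in> S then f (p n t) else 0)" for n t
  define I where "I n = {- int (n * Suc n) - 1 .. int (n * Suc n)}" for n
  define q where "q n t = \<lfloor>t * real (Suc n)\<rfloor>" for n t
  define h where "h n k = (if real_of_int k / real (Suc n) \<in> S then f (real_of_int k / real (Suc n)) else 0)" for n k
  have g_alt: "g n t = (if \<bar>t\<bar> \<le> real n then h n (q n t) else 0)" for n t
    by (simp only: g_def p_def q_def h_def split: if_splits) blast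
  have qI: "q n t \<in> I n" if t: "\<bar>t\<bar> \<le> real n" for n t
  proof -
    have "\<bar>t * real (Suc n)\<bar> \<le> real (n * Suc n)"
      using mult_right_mono[OF t, of "real (Suc n)"] by (simp only: abs_mult abs_of_nat of_nat_mult)
    then have "- real_of_int (int (n * Suc n)) \<le> t * real (Suc n)" "t * real (Suc n) \<le> real_of_int (int (n * Suc n))"
      by linarith+
    then show ?thesis unfolding I_def q_def atLeastAtMost_iff by linarith
  qed
  have fin: "finite (range (g n))" for n
  proof (rule finite_subset)
    show "range (g n) \<subseteq> insert 0 (h n ` I n)" using qI by (auto simp: g_alt)
  qed (simp add: I_def)
  have meas: "g n -` {y} \<in> sets lebesgue" for n y
  proof -
    have "q n \<in> measurable borel (count_space UNIV)"
      unfolding q_def by measurable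
    then have "q n -` (h n -` {y}) \<in> sets borel"
      using measurable_sets[of "q n" borel "count_space UNIV" "h n -` {y}"] by simp
    moreover have "{t. \<bar>t\<bar> \<le> real n} \<in> sets borel" by measurable
    moreover have "g n -` {y} = ({t. \<bar>t\<bar> \<le> real n} \<inter> q n -` (h n -` {y})) \<union> (if y = 0 then - {t. \<bar>t\<bar> \<le> real n} else {})"
      by (auto simp: g_alt split: if_splits)
    ultimately have "g n -` {y} \<in> sets borel" by (simp add: sets.Un sets.Int borel_comp)
    then show ?thesis by auto
  qed
  have lim: "(\<lambda>n. g n t) \<longlonglongrightarrow> f t" if "t \<in> S" for t
  proof -
    have plim: "(\<lambda>n. p n t) \<longlonglongrightarrow> t"
    proof (rule tendsto_sandwich[of "\<lambda>n. t - 1 / real (Suc n)" _ _ "\<lambda>n. t"])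
      have "t - 1 / real (Suc n) \<le> p n t \<and> p n t \<le> t" for n
      proof -
        have "t * real (Suc n) - 1 \<le> real_of_int \<lfloor>t * real (Suc n)\<rfloor>"
          "real_of_int \<lfloor>t * real (Suc n)\<rfloor> \<le> t * real (Suc n)" by linarith+
        then have "(t * real (Suc n) - 1) / real (Suc n) \<le> p n t" "p n t \<le> t * real (Suc n) / real (Suc n)"
          unfolding p_def by (intro divide_right_mono; simp)+
        then show ?thesis by (simp only: diff_divide_distrib) simp
      qed
      then show "\<forall>\<^sub>F n in sequentially. t - 1 / real (Suc n) \<le> p n t"
        "\<forall>\<^sub>F n in sequentially. p n t \<le> t" by auto
      show "(\<lambda>n. t - 1 / real (Suc n)) \<longlonglongrightarrow> t"
        using tendsto_diff[OF tendsto_const LIMSEQ_inverse_real_of_nat, of t] by (simp add: inverse_eq_divide)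
    qed simp
    have "isCont f t" using f S that by (simp add: continuous_on_eq_continuous_at)
    then have "(\<lambda>n. f (p n t)) \<longlonglongrightarrow> f t" using plim by (rule isCont_tendsto_compose)
    moreover have "\<forall>\<^sub>F n in sequentially. p n t \<in> S"
      using plim S that by (rule topological_tendstoD)
    moreover have "\<forall>\<^sub>F n in sequentially. \<bar>t\<bar> \<le> real n"
      using filterlim_real_sequentially by (simp add: filterlim_at_top)
    ultimately show ?thesis
    proof (elim Lim_transform_eventually)
      assume "\<forall>\<^sub>F n in sequentially. p n t \<in> S" "\<forall>\<^sub>F n in sequentially. \<bar>t\<bar> \<le> real n"
      then show "\<forall>\<^sub>F n in sequentially. f (p n t) = g n t"
        by eventually_elim (simp add: g_def)
    qed
  qed
  show ?thesis
    unfolding strongly_measurable_on_def using fin meas lim by (intro exI[of _ g]) auto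
qed

section \<open>Hankel contour integrals and their independence of the radius\<close>

definition ray_integral :: "real \<Rightarrow> (complex \<Rightarrow> 'a::cbanach) \<Rightarrow> real \<Rightarrow> 'a" where
  "ray_integral ph f r = integral {r..} (\<lambda>x. cis ph *\<^sub>C f (of_real x * cis ph))"

definition arc_integral :: "real \<Rightarrow> (complex \<Rightarrow> 'a::cbanach) \<Rightarrow> real \<Rightarrow> 'a" where
  "arc_integral th f r =
     integral {- th..th} (\<lambda>ph. (\<i> * cis ph * of_real r) *\<^sub>C f (of_real r * cis ph))"

definition hankel_integral :: "real \<Rightarrow> (complex \<Rightarrow> 'a::cbanach) \<Rightarrow> real \<Rightarrow> 'a" where
  "hankel_integral th f r = ray_integral th f r - ray_integral (- th) f r + arc_integral th f r"

text \<open>Closed in the angle, so that both rays of the contour belong to it; the apex is left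
  out, so the contour arcs of every radius fit.\<close>

definition closed_sector :: "real \<Rightarrow> complex set" where
  "closed_sector th = {of_real r * cis ph | r ph. r > 0 \<and> \<bar>ph\<bar> \<le> th}"

lemma closed_sectorI: "r > 0 \<Longrightarrow> \<bar>ph\<bar> \<le> th \<Longrightarrow> of_real r * cis ph \<in> closed_sector th"
  unfolding closed_sector_def by blast

text \<open>The derivative is taken in a full complex neighbourhood, also at boundary points of
  \<open>S\<close>. Continuity of the derivative is part of the notion because it is what
  differentiation under the arc integral requires.\<close>

definition holo_on :: "(complex \<Rightarrow> 'a::cbanach) \<Rightarrow> complex set \<Rightarrow> bool" where
  "holo_on f S \<longleftrightarrow>
     (\<exists>f'. (\<forall>z\<in>S. (f has_derivative (\<lambda>h. h *\<^sub>C f' z)) (at z)) \<and> continuous_on S f')"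

lemma holo_onI:
  "(\<And>z. z \<in> S \<Longrightarrow> (f has_derivative (\<lambda>h. h *\<^sub>C f' z)) (at z)) \<Longrightarrow> continuous_on S f' \<Longrightarrow> holo_on f S"
  unfolding holo_on_def by blast

lemma holo_on_imp_continuous_on: "holo_on f S \<Longrightarrow> continuous_on S f"
  unfolding holo_on_def
  by (meson continuous_at_imp_continuous_on has_derivative_continuous)

lemma holo_on_const: "holo_on (\<lambda>z. x) S"
  by (rule holo_onI[where f' = "\<lambda>_. 0"]) (auto simp: cscale.zero_right)

lemma holo_on_diff:
  assumes "holo_on f S" "holo_on g S" shows "holo_on (\<lambda>z. f z - g z) S"
proof -
  from assms obtain f' g' where
    "\<And>z. z \<in> S \<Longrightarrow> (f has_derivative (\<lambda>h. h *\<^sub>C f' z)) (at z)" "continuous_on S f'"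
    "\<And>z. z \<in> S \<Longrightarrow> (g has_derivative (\<lambda>h. h *\<^sub>C g' z)) (at z)" "continuous_on S g'"
    unfolding holo_on_def by metis
  then show ?thesis
    by (intro holo_onI[where f' = "\<lambda>z. f' z - g' z"])
       (auto simp: cscale.diff_right intro!: has_derivative_diff continuous_intros)
qed

lemma holo_on_cscale:
  assumes "holo_on f S" and g: "\<And>z. z \<in> S \<Longrightarrow> (g has_field_derivative g' z) (at z)"
    and g': "continuous_on S g'"
  shows "holo_on (\<lambda>z. g z *\<^sub>C f z) S"
proof -
  from assms obtain f' where f': "\<And>z. z \<in> S \<Longrightarrow> (f has_derivative (\<lambda>h. h *\<^sub>C f' z)) (at z)" "continuous_on S f'"
    unfolding holo_on_def by metis
  have "continuous_on S g" using g by (meson DERIV_isCont continuous_at_imp_continuous_on)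
  show ?thesis
  proof (rule holo_onI[where f' = "\<lambda>z. g z *\<^sub>C f' z + g' z *\<^sub>C f z"])
    fix z assume "z \<in> S"
    from cscale.FDERIV[OF g[OF this, unfolded has_field_derivative_def] f'(1)[OF this]]
    show "((\<lambda>z. g z *\<^sub>C f z) has_derivative (\<lambda>h. h *\<^sub>C (g z *\<^sub>C f' z + g' z *\<^sub>C f z))) (at z)"
      by (simp add: cscale_add_right cscale_cscale mult.commute)
  qed (intro continuous_intros assms holo_on_imp_continuous_on f' \<open>continuous_on S g\<close>)
qed

lemma has_vector_derivative_holo:
  assumes "(g has_vector_derivative g') (at x within U)" "(f has_derivative (\<lambda>h. h *\<^sub>C f')) (at (g x))"
  shows "((\<lambda>x. f (g x)) has_vector_derivative (g' *\<^sub>C f')) (at x within U)"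
proof -
  have "((\<lambda>x. f (g x)) has_derivative (\<lambda>h. (h *\<^sub>R g') *\<^sub>C f')) (at x within U)"
    using has_derivative_compose[OF assms(1)[unfolded has_vector_derivative_def] assms(2)] .
  then show ?thesis
    by (simp add: has_vector_derivative_def cscale.scaleR_left)
qed

lemma has_vector_derivative_cis: "(cis has_vector_derivative \<i> * cis x) (at x within U)"
proof -
  have "((\<lambda>x. exp (\<i> * of_real x)) has_vector_derivative \<i> * exp (\<i> * of_real x)) (at x within U)"
    by (rule derivative_eq_intros has_vector_derivative_real_field | simp)+
  moreover have "cis = (\<lambda>x. exp (\<i> * of_real x))" by (simp add: cis_conv_exp fun_eq_iff)
  ultimately show ?thesis by (simp only: cis_conv_exp)
qed

lemma continuous_on_polar:
  assumes "continuous_on (closed_sector th) f"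
  shows "continuous_on ({0<..} \<times> cbox (-th) th) (\<lambda>z. f (of_real (fst z) * cis (snd z)))"
  by (rule continuous_on_compose2[OF assms])
     (auto intro!: continuous_intros closed_sectorI)

text \<open>This plays the role of Cauchy's theorem. In polar coordinates the radial derivative of
  the arc integrand is also an angular derivative, so integrating it over the angle leaves only the
  two boundary terms.\<close>

lemma has_vector_derivative_arc_integral:
  assumes f: "holo_on f (closed_sector th)" and "th \<ge> 0" "r > 0"
  shows "(arc_integral th f has_vector_derivative
     (cis th *\<^sub>C f (of_real r * cis th) - cis (- th) *\<^sub>C f (of_real r * cis (- th)))) (at r)"
proof -
  from f obtain f' where f': "\<And>z. z \<in> closed_sector th \<Longrightarrow> (f has_derivative (\<lambda>h. h *\<^sub>C f' z)) (at z)"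
    and contf': "continuous_on (closed_sector th) f'"
    unfolding holo_on_def by blast
  note contf = holo_on_imp_continuous_on[OF f]
  \<comment> \<open>\<open>F' x ph\<close> is both the x-derivative of i x e^(i ph) f(x e^(i ph))
    and the ph-derivative of e^(i ph) f(x e^(i ph)).\<close>
  define F' where "F' x ph = (\<i> * cis ph) *\<^sub>C f (of_real x * cis ph)
      + (\<i> * cis ph * of_real x) *\<^sub>C (cis ph *\<^sub>C f' (of_real x * cis ph))" for x ph
  have S: "of_real x * cis ph \<in> closed_sector th" if "x \<in> {0<..}" "ph \<in> cbox (-th) th" for x ph :: real
    using that by (auto intro!: closed_sectorI)
  have "((\<lambda>x. integral (cbox (-th) th) (\<lambda>ph. (\<i> * cis ph * of_real x) *\<^sub>C f (of_real x * cis ph)))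
      has_vector_derivative integral (cbox (-th) th) (F' r)) (at r within {0<..})"
  proof (rule leibniz_rule_vector_derivative)
    fix x ph :: real assume x: "x \<in> {0<..}" and ph: "ph \<in> cbox (-th) th"
    have "((\<lambda>x. f (of_real x * cis ph)) has_vector_derivative cis ph *\<^sub>C f' (of_real x * cis ph)) (at x within {0<..})"
      by (rule has_vector_derivative_holo[where g = "\<lambda>x. of_real x * cis ph", OF _ f'[OF S[OF x ph]]])
         (auto intro!: derivative_eq_intros has_vector_derivative_real_field)
    moreover have "((\<lambda>x. \<i> * cis ph * of_real x) has_vector_derivative \<i> * cis ph) (at x within {0<..})"
      by (auto intro!: derivative_eq_intros has_vector_derivative_real_field)
    ultimately show "((\<lambda>x. (\<i> * cis ph * of_real x) *\<^sub>C f (of_real x * cis ph)) has_vector_derivative F' x ph) (at x within {0<..})"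
      unfolding F'_def by (subst add.commute) (rule cscale.has_vector_derivative)
  next
    fix x :: real assume x: "x \<in> {0<..}"
    have "continuous_on (cbox (-th) th) (\<lambda>ph. f (of_real x * cis ph))"
      by (rule continuous_on_compose2[OF contf]) (use S[OF x] in \<open>auto intro!: continuous_intros\<close>)
    then show "(\<lambda>ph. (\<i> * cis ph * of_real x) *\<^sub>C f (of_real x * cis ph)) integrable_on cbox (-th) th"
      by (intro integrable_continuous continuous_intros)
  next
    show "continuous_on ({0<..} \<times> cbox (-th) th) (\<lambda>(x, ph). F' x ph)"
      unfolding F'_def case_prod_unfold
      by (intro continuous_intros continuous_on_polar contf contf')
  qed (use assms in auto)
  moreover have "integral (cbox (-th) th) (F' r)
      = cis th *\<^sub>C f (of_real r * cis th) - cis (- th) *\<^sub>C f (of_real r * cis (- th))"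
  proof (rule integral_unique, unfold cbox_interval, rule fundamental_theorem_of_calculus)
    fix ph assume ph: "ph \<in> {-th..th}"
    have "((\<lambda>ph. f (of_real r * cis ph)) has_vector_derivative (of_real r * (\<i> * cis ph)) *\<^sub>C f' (of_real r * cis ph)) (at ph within {-th..th})"
      by (rule has_vector_derivative_holo[where g = "\<lambda>ph. of_real r * cis ph", OF _ f'[OF S]])
         (use ph \<open>r > 0\<close> in \<open>auto intro!: has_vector_derivative_mult_right has_vector_derivative_cis\<close>)
    from cscale.has_vector_derivative[OF has_vector_derivative_cis this]
    show "((\<lambda>ph. cis ph *\<^sub>C f (of_real r * cis ph)) has_vector_derivative F' r ph) (at ph within {-th..th})"
      unfolding F'_def by (simp add: cscale_cscale mult_ac add.commute)
  qed (use assms in auto)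
  ultimately have "((\<lambda>x. integral (cbox (-th) th) (\<lambda>ph. (\<i> * cis ph * of_real x) *\<^sub>C f (of_real x * cis ph)))
      has_vector_derivative (cis th *\<^sub>C f (of_real r * cis th) - cis (- th) *\<^sub>C f (of_real r * cis (- th)))) (at r within {0<..})"
    by simp
  moreover have "at r within {0<..} = at r" using \<open>r > 0\<close> by (intro at_within_open) auto
  ultimately show ?thesis
    by (simp add: arc_integral_def[abs_def])
qed

text \<open>Between the radii \<open>r\<close> and \<open>N\<close> the arc gains exactly what the
  difference of the two rays loses.\<close>

lemma hankel_integral_radius_less:
  assumes f: "holo_on f (closed_sector th)" and th: "th \<ge> 0" and r: "0 < r" "r \<le> N"
    and int: "\<And>x ph. x > 0 \<Longrightarrow> ph \<in> {th, -th} \<Longrightarrow> (\<lambda>x. cis ph *\<^sub>C f (of_real x * cis ph)) integrable_on {x..}"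
  shows "hankel_integral th f r = hankel_integral th f N"
proof -
  define g where "g ph = (\<lambda>x. cis ph *\<^sub>C f (of_real x * cis ph))" for ph
  have g: "g ph integrable_on {x..}" if "x > 0" "ph \<in> {th, -th}" for x ph
    using int that by (simp add: g_def)
  have gi: "g ph integrable_on {r..N}" if "ph \<in> {th, -th}" for ph
    using integrable_on_subinterval[OF g[OF r(1) that], of r N] by auto
  have ray: "ray_integral ph f r = integral {r..N} (g ph) + ray_integral ph f N" if "ph \<in> {th, -th}" for ph
  proof -
    have "integral ({r..N} \<union> {N..}) (g ph) = integral {r..N} (g ph) + integral {N..} (g ph)"
    proof (rule integral_Un)
      have "{r..N} \<inter> {N..} = {N}" using r by auto
      then show "negligible ({r..N} \<inter> {N..})" by simp
    qed (use gi g r that in auto)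
    moreover have "{r..N} \<union> {N..} = {r..}" using r by auto
    ultimately show ?thesis by (simp add: ray_integral_def g_def)
  qed
  have "((\<lambda>x. g th x - g (-th) x) has_integral (arc_integral th f N - arc_integral th f r)) {r..N}"
    unfolding g_def using r th
    by (intro fundamental_theorem_of_calculus has_vector_derivative_arc_integral[THEN has_vector_derivative_at_within] f) auto
  moreover have "integral {r..N} (\<lambda>x. g th x - g (-th) x) = integral {r..N} (g th) - integral {r..N} (g (-th))"
    by (intro Henstock_Kurzweil_Integration.integral_diff gi) auto
  ultimately have "arc_integral th f N - arc_integral th f r = integral {r..N} (g th) - integral {r..N} (g (-th))"
    by (simp add: integral_unique)
  then show ?thesis
    using ray[of th] ray[of "-th"] unfolding hankel_integral_def by (simp add: algebra_simps)
qed

section \<open>Inverse Laplace integrals of symbols with power decay\<close>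

text \<open>Trades exponential decay for a power whose exponent is still free; different choices of
  \<open>b\<close> are needed for pointwise limits and for limits under an integral in time.\<close>

lemma exp_minus_le_powr:
  fixes y b :: real
  assumes "y > 0" "0 \<le> b" "b \<le> 1"
  shows "exp (- y) \<le> y powr (- b)"
proof -
  have "y powr b \<le> exp y"
  proof (cases "y \<le> 1")
    case True
    then have "y powr b \<le> 1" using assms by (simp add: powr_le1)
    also have "1 \<le> exp y" using assms by simp
    finally show ?thesis .
  next
    case False
    then have "y powr b \<le> y powr 1" using assms by (intro powr_mono) auto
    also have "\<dots> \<le> exp y" using assms exp_ge_add_one_self[of y] by (simp del: exp_ge_add_one_self)
    finally show ?thesis .
  qed
  then have "inverse (exp y) \<le> inverse (y powr b)" using assms by (intro le_imp_inverse_le) auto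
  then show ?thesis by (simp add: exp_minus powr_minus)
qed

locale hankel_symbol =
  fixes th p C :: real and w :: "complex \<Rightarrow> 'a::cbanach"
  assumes th: "pi / 2 < th" "th < pi"
    and holo: "holo_on w (closed_sector th)"
    and bound: "\<And>z. z \<in> closed_sector th \<Longrightarrow> norm (w z) \<le> C * cmod z powr p"
    and p: "p < 0" and C: "C \<ge> 0"
begin

definition f :: "real \<Rightarrow> complex \<Rightarrow> 'a" where
  "f s z = exp (z * of_real s) *\<^sub>C w z"

text \<open>The decay rate on the rays: there Re(\<lambda> s) = -\<open>c\<close> |\<lambda>| s, and
  \<open>c > 0\<close> because the angle exceeds pi/2.\<close>

definition c :: real where "c = - cos th"

lemma c_pos: "c > 0"
proof -
  have "cos (pi - th) > 0" using th by (intro cos_gt_zero_pi) auto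
  then show ?thesis by (simp add: c_def)
qed

lemma th_nonneg: "th \<ge> 0" using th pi_gt_zero by linarith

lemma holo_f: "holo_on (f s) (closed_sector th)"
  unfolding f_def
  by (rule holo_on_cscale[OF holo, where g' = "\<lambda>z. exp (z * of_real s) * of_real s"])
     (auto intro!: derivative_eq_intros continuous_intros)

lemma norm_f_arc:
  assumes "r > 0" "\<bar>ph\<bar> \<le> th"
  shows "norm (f s (of_real r * cis ph)) \<le> exp (r * s * cos ph) * (C * r powr p)"
proof -
  have "norm (f s (of_real r * cis ph)) = exp (r * s * cos ph) * norm (w (of_real r * cis ph))"
    by (simp add: f_def norm_cscale mult_ac)
  also have "\<dots> \<le> exp (r * s * cos ph) * (C * r powr p)"
    using bound[OF closed_sectorI[OF assms]] assms by (intro mult_left_mono) (auto simp: norm_mult)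
  finally show ?thesis .
qed

text \<open>With exp(-c s x) \<le> (c s x)^(-b) the integrand is dominated by a multiple of x^(p -
  b), integrable at infinity since p - b < -1. The dependence on \<open>s\<close> and on
  \<open>N\<close> separates into two factors.\<close>

lemma ray_integrable_bound:
  assumes ph: "ph \<in> {th, - th}" and s: "s > 0" and N: "N > 0" and b: "0 \<le> b" "b \<le> 1" "p + 1 < b"
  shows "(\<lambda>x. cis ph *\<^sub>C f s (of_real x * cis ph)) integrable_on {N..}" (is ?int)
    and "norm (ray_integral ph (f s) N) \<le> C * (c * s) powr (- b) * N powr (p - b + 1) / (b - p - 1)" (is ?bound)
proof -
  let ?g = "\<lambda>x. C * (c * s) powr (- b) * x powr (p - b)"
  have g: "(?g has_integral C * (c * s) powr (- b) * (- (N powr (p - b + 1)) / (p - b + 1))) {N..}"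
    using b N by (intro has_integral_mult_right has_integral_powr_to_inf) auto
  have le: "norm (cis ph *\<^sub>C f s (of_real x * cis ph)) \<le> ?g x" if "x \<in> {N..}" for x
  proof -
    have x: "x > 0" using that N by simp
    have "norm (cis ph *\<^sub>C f s (of_real x * cis ph)) \<le> exp (x * s * cos ph) * (C * x powr p)"
      using norm_f_arc[OF x, of ph s] ph th_nonneg by (auto simp: norm_cscale)
    also have "exp (x * s * cos ph) = exp (- (c * s * x))" using ph by (auto simp: c_def mult_ac)
    also have "exp (- (c * s * x)) \<le> (c * s * x) powr (- b)"
      using x s c_pos b by (intro exp_minus_le_powr) auto
    also have "\<dots> = (c * s) powr (- b) * x powr (- b)"
      using x s c_pos by (intro powr_mult) 
    also have "(c * s) powr (- b) * x powr (- b) * (C * x powr p) = ?g x"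
      by (simp add: powr_diff powr_minus divide_inverse mult_ac)
    finally show ?thesis using C by (simp add: mult_right_mono)
  qed
  have cont: "continuous_on {N..} (\<lambda>x. cis ph *\<^sub>C f s (of_real x * cis ph))"
    using N ph th_nonneg
    by (intro continuous_intros continuous_on_compose2[OF holo_on_imp_continuous_on[OF holo_f]])
       (auto intro!: closed_sectorI)
  show ?int
    using integrable_on_ray_dominated[OF cont has_integral_integrable[OF g]] le by auto
  have "norm (ray_integral ph (f s) N) \<le> integral {N..} ?g"
    unfolding ray_integral_def
    by (rule integral_norm_bound_integral[OF \<open>?int\<close> has_integral_integrable[OF g] le])
  also have "\<dots> = C * (c * s) powr (- b) * N powr (p - b + 1) / (b - p - 1)"
    using integral_unique[OF g] b by (simp add: field_simps)
  finally show ?bound .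
qed

text \<open>The inverse Laplace transform of \<open>w\<close> up to the factor 1/(2 pi i). The
  radius 1/s is the one occurring in \<open>Gop\<close>; by \<open>hankel_integral_eq\<close> any
  other radius gives the same value.\<close>

definition F :: "real \<Rightarrow> 'a" where "F s = hankel_integral th (f s) (1 / s)"

lemma hankel_integral_eq:
  assumes "s > 0" "r > 0" shows "hankel_integral th (f s) r = F s"
proof -
  have *: "hankel_integral th (f s) r = hankel_integral th (f s) N" if "0 < r" "r \<le> N" for r N
    using ray_integrable_bound(1)[OF _ \<open>s > 0\<close>, of _ _ 1] p that
    by (intro hankel_integral_radius_less holo_f th_nonneg) auto
  show ?thesis
    unfolding F_def using assms *[of r "1/s"] *[of "1/s" r, symmetric]
    by (cases "r \<le> 1/s") (blast, simp only: not_le zero_less_divide_1_iff less_imp_le)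
qed

text \<open>Once the contour is moved to radius \<open>N\<close>, the difference consists of the two
  ray tails alone.\<close>

lemma F_minus_arc_bound:
  assumes "s > 0" "N > 0" "0 \<le> b" "b \<le> 1" "p + 1 < b"
  shows "norm (F s - arc_integral th (f s) N) \<le> 2 * (C * (c * s) powr (- b) * N powr (p - b + 1) / (b - p - 1))"
proof -
  have "F s - arc_integral th (f s) N = ray_integral th (f s) N - ray_integral (- th) (f s) N"
    unfolding hankel_integral_eq[OF assms(1,2), symmetric] hankel_integral_def by simp
  then show ?thesis
    using ray_integrable_bound(2)[OF _ assms, of th] ray_integrable_bound(2)[OF _ assms, of "- th"]
      norm_triangle_ineq4[of "ray_integral th (f s) N" "ray_integral (- th) (f s) N"] by simp
qed

lemma continuous_on_arc:
  assumes "N > 0"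
  shows "continuous_on {- th..th} (\<lambda>ph. (\<i> * cis ph * of_real N) *\<^sub>C f s (of_real N * cis ph))"
  using assms
  by (intro continuous_intros continuous_on_compose2[OF holo_on_imp_continuous_on[OF holo_f]])
       (auto intro!: closed_sectorI)

text \<open>Scaling: at radius 1/s the exponential is at most e on the arc, whose length is
  proportional to 1/s, and the symbol is at most C s^(-p) there. The tails with \<open>b = 1\<close>
  have the same order.\<close>

lemma F_bound: "\<exists>K\<ge>0. \<forall>s>0. norm (F s) \<le> K * s powr (- p - 1)"
proof (intro exI conjI allI impI)
  \<comment> \<open>The first summand comes from the two rays with \<open>b = 1\<close>, the second
    from the arc of angle 2 \<open>th\<close>.\<close>
  let ?K = "2 * (C * c powr (- 1) / (- p)) + exp 1 * C * (2 * th)"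
  show "?K \<ge> 0" using C p th_nonneg by (intro add_nonneg_nonneg mult_nonneg_nonneg divide_nonneg_nonneg) auto
  fix s :: real assume s: "s > 0"
  have "norm (F s - arc_integral th (f s) (1/s))
      \<le> 2 * (C * (c * s) powr (- 1) * (1 / s) powr (p - 1 + 1) / (1 - p - 1))"
    using s p by (intro F_minus_arc_bound) auto
  also have "\<dots> = 2 * (C * ((c * s) powr (- 1) * (1 / s) powr p) / (- p))"
    by (simp only: mult.assoc) simp
  also have "(c * s) powr (- 1) * (1 / s) powr p = c powr (- 1) * s powr (- p - 1)"
    using s c_pos by (simp add: powr_mult powr_divide powr_minus powr_diff divide_simps)
  finally have 1: "norm (F s - arc_integral th (f s) (1/s)) \<le> 2 * (C * c powr (- 1) / (- p)) * s powr (- p - 1)"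
    by (simp only: times_divide_eq_left times_divide_eq_right mult.assoc)
  have "norm (arc_integral th (f s) (1/s)) \<le> (exp 1 * C * s powr (- p - 1)) * measure lborel {- th..th}"
    unfolding arc_integral_def
  proof (rule has_integral_bound_real[of _ "{}"])
    show "0 \<le> exp 1 * C * s powr (- p - 1)" using C by simp
    show "((\<lambda>ph. (\<i> * cis ph * of_real (1/s)) *\<^sub>C f s (of_real (1/s) * cis ph)) has_integral
       integral {- th..th} (\<lambda>ph. (\<i> * cis ph * of_real (1/s)) *\<^sub>C f s (of_real (1/s) * cis ph))) {- th..th}"
      using s by (intro integrable_integral integrable_continuous_interval continuous_on_arc) auto
    fix ph assume "ph \<in> {- th..th} - {}"
    then have ph: "\<bar>ph\<bar> \<le> th" by auto
    have "norm ((\<i> * cis ph * of_real (1/s)) *\<^sub>C f s (of_real (1/s) * cis ph)) = (1/s) * norm (f s (of_real (1/s) * cis ph))"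
      using s by (simp add: norm_cscale norm_mult norm_divide)
    also have "\<dots> \<le> (1/s) * (exp (1/s * s * cos ph) * (C * (1/s) powr p))"
      using s ph by (intro mult_left_mono norm_f_arc) auto
    also have "\<dots> \<le> (1/s) * (exp 1 * (C * (1/s) powr p))"
      using s C by (intro mult_left_mono mult_right_mono) auto
    also have "\<dots> = exp 1 * C * s powr (- p - 1)"
      using s by (simp add: powr_divide powr_minus powr_diff divide_simps)
    finally show "norm ((\<i> * cis ph * of_real (1/s)) *\<^sub>C f s (of_real (1/s) * cis ph)) \<le> exp 1 * C * s powr (- p - 1)" .
  qed simp
  then have 2: "norm (arc_integral th (f s) (1/s)) \<le> exp 1 * C * (2 * th) * s powr (- p - 1)"
    using th_nonneg by (simp add: mult_ac)
  show "norm (F s) \<le> ?K * s powr (- p - 1)"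
    using norm_triangle_mono[OF 1 2] by (simp add: algebra_simps)
qed

lemma continuous_on_arc_integral:
  assumes "N > 0"
  shows "continuous_on UNIV (\<lambda>s. arc_integral th (f s) N)"
proof -
  have "continuous_on (UNIV \<times> cbox (- th) th) (\<lambda>(s, ph). (\<i> * cis ph * of_real N) *\<^sub>C f s (of_real N * cis ph))"
    unfolding f_def case_prod_unfold using assms
    by (intro continuous_intros continuous_on_compose2[OF holo_on_imp_continuous_on[OF holo]])
       (auto intro!: closed_sectorI)
  from integral_continuous_on_param[OF this] show ?thesis
    by (simp add: arc_integral_def)
qed

lemma arc_integral_tendsto_F:
  assumes "s > 0"
  shows "(\<lambda>n. arc_integral th (f s) (real (Suc n))) \<longlonglongrightarrow> F s"
proof (rule LIM_zero_cancel, rule Lim_null_comparison)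
  have "norm (arc_integral th (f s) (real (Suc n)) - F s) \<le> 2 * (C * (c * s) powr (- 1) * real (Suc n) powr (p - 1 + 1) / (1 - p - 1))" for n
    using F_minus_arc_bound[OF assms, of "real (Suc n)" 1] p by (simp add: norm_minus_commute del: of_nat_Suc)
  then show "\<forall>\<^sub>F n in sequentially. norm (arc_integral th (f s) (real (Suc n)) - F s)
      \<le> 2 * (C * (c * s) powr (- 1) * real (Suc n) powr (p - 1 + 1) / (1 - p - 1))" by auto
  have "(\<lambda>n. real (Suc n) powr p) \<longlonglongrightarrow> 0"
    using tendsto_neg_powr[OF p filterlim_real_sequentially] by (rule LIMSEQ_Suc)
  then have "(\<lambda>n. 2 * (C * (c * s) powr (- 1) * real (Suc n) powr p / (- p))) \<longlonglongrightarrow> 2 * (C * (c * s) powr (- 1) * 0 / (- p))"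
    using p by (intro tendsto_intros) auto
  then show "(\<lambda>n. 2 * (C * (c * s) powr (- 1) * real (Suc n) powr (p - 1 + 1) / (1 - p - 1))) \<longlonglongrightarrow> 0"
    by simp
qed

text \<open>The arc integrals are continuous in \<open>s\<close> and converge uniformly, but only
  away from 0, since the tail bound blows up like 1/s. Hence the detour through the half-lines
  \<open>{a<..}\<close>.\<close>

lemma continuous_on_F: "continuous_on {0<..} F"
proof -
  have "continuous_on {a<..} F" if a: "a > 0" for a
  proof (rule uniform_limit_theorem[of _ "\<lambda>n s. arc_integral th (f s) (real (Suc n))"])
    show "\<forall>\<^sub>F n in sequentially. continuous_on {a<..} (\<lambda>s. arc_integral th (f s) (real (Suc n)))"
      by (intro always_eventually allI continuous_on_subset[OF continuous_on_arc_integral]) auto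
    show "uniform_limit {a<..} (\<lambda>n s. arc_integral th (f s) (real (Suc n))) F sequentially"
    proof (rule uniform_limitI)
      fix e :: real assume "e > 0"
      define K where "K n = 2 * (C * (c * a) powr (- 1) * real (Suc n) powr p / (- p))" for n
      have "(\<lambda>n. real (Suc n) powr p) \<longlonglongrightarrow> 0"
        using tendsto_neg_powr[OF p filterlim_real_sequentially] by (rule LIMSEQ_Suc)
      then have "K \<longlonglongrightarrow> 2 * (C * (c * a) powr (- 1) * 0 / (- p))"
        unfolding K_def using p by (intro tendsto_intros) auto
      then have "\<forall>\<^sub>F n in sequentially. K n < e" using \<open>e > 0\<close> by (intro order_tendstoD) auto
      then show "\<forall>\<^sub>F n in sequentially. \<forall>s\<in>{a<..}. dist (arc_integral th (f s) (real (Suc n))) (F s) < e"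
      proof eventually_elim
        case (elim n)
        show ?case
        proof
          fix s assume s: "s \<in> {a<..}"
          then have "s > 0" using a by simp
          have "(c * s) powr (- 1) \<le> (c * a) powr (- 1)"
            using s a c_pos by (intro powr_mono2') auto
          moreover have e: "p - 1 + 1 = p" "1 - p - 1 = - p" by simp_all
          ultimately have "2 * (C * (c * s) powr (- 1) * real (Suc n) powr (p - 1 + 1) / (1 - p - 1)) \<le> K n"
            using C p unfolding K_def e
            by (intro mult_left_mono divide_right_mono mult_right_mono) simp_all
          then show "dist (arc_integral th (f s) (real (Suc n))) (F s) < e"
            using F_minus_arc_bound[OF \<open>s > 0\<close>, of "real (Suc n)" 1] p elim
            by (simp add: dist_norm norm_minus_commute del: of_nat_Suc)
        qed
      qed
    qed
  qed simp
  then have "isCont F s" if "s > 0" for s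
    using that continuous_on_interior[of "{s/2<..}" F s] by (simp add: interior_open)
  then show ?thesis by (auto intro: continuous_at_imp_continuous_on)
qed

end

section \<open>The inverse Laplace transform of 1/\<lambda>\<close>

text \<open>The mean value property of exp. The x-derivative of the integral vanishes because its
  integrand is the angular derivative of a 2 pi-periodic function; hence the value at x = 0
  persists.\<close>

lemma integral_exp_circle:
  fixes x :: real
  assumes "x \<ge> 0"
  shows "integral {- pi..pi} (\<lambda>ph. exp (of_real x * cis ph)) = 2 * of_real pi"
proof -
  define I where "I x = integral (cbox (- pi) pi) (\<lambda>ph. exp (of_real x * cis ph))" for x :: real
  have deriv: "(I has_vector_derivative integral (cbox (- pi) pi) (\<lambda>ph. cis ph * exp (of_real u * cis ph)))
      (at u within UNIV)" for u
    unfolding I_def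
  proof (rule leibniz_rule_vector_derivative)
    fix u ph :: real
    show "((\<lambda>x. exp (of_real x * cis ph)) has_vector_derivative cis ph * exp (of_real u * cis ph)) (at u within UNIV)"
      by (rule derivative_eq_intros has_vector_derivative_real_field | simp)+
  qed (auto simp: case_prod_unfold intro!: integrable_continuous_interval continuous_intros)
  \<comment> \<open>The antiderivative divides by \<open>u\<close>, which excludes
    \<open>u = 0\<close>; that end point is covered later by continuity of \<open>I\<close>.\<close>
  have *: "((\<lambda>ph. cis ph * exp (of_real u * cis ph)) has_integral
      exp (of_real u * cis pi) / (\<i> * of_real u) - exp (of_real u * cis (- pi)) / (\<i> * of_real u)) {- pi..pi}"
    if "u > 0" for u
  proof (rule fundamental_theorem_of_calculus)
    fix ph :: real
    have "((\<lambda>z. exp (of_real u * z) / (\<i> * of_real u)) has_field_derivative exp (of_real u * cis ph) / \<i>) (at (cis ph))"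
      using that by (auto intro!: derivative_eq_intros)
    from field_vector_diff_chain_within[OF has_vector_derivative_cis has_field_derivative_at_within[OF this]]
    have "((\<lambda>ph. exp (of_real u * cis ph) / (\<i> * of_real u)) has_vector_derivative \<i> * cis ph * (exp (of_real u * cis ph) / \<i>))
        (at ph within {- pi..pi})"
      unfolding o_def .
    moreover have "\<i> * cis ph * (exp (of_real u * cis ph) / \<i>) = cis ph * exp (of_real u * cis ph)"
      by (simp only: mult.assoc times_divide_eq_right nonzero_mult_div_cancel_left[OF complex_i_not_zero])
    ultimately show "((\<lambda>ph. exp (of_real u * cis ph) / (\<i> * of_real u)) has_vector_derivative cis ph * exp (of_real u * cis ph))
        (at ph within {- pi..pi})"
      by metis
  qed simp
  have zero: "integral (cbox (- pi) pi) (\<lambda>ph. cis ph * exp (of_real u * cis ph)) = 0" if "u > 0" for u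
  proof -
    have "cis (- pi) = cis pi" by (simp add: complex_eq_iff)
    with that * show ?thesis by (simp add: integral_unique)
  qed
  have "((\<lambda>_. 0) has_integral (I x - I 0)) {0..x}"
  proof (rule fundamental_theorem_of_calculus_interior[OF assms])
    show "continuous_on {0..x} I"
      using deriv by (intro continuous_at_imp_continuous_on ballI has_vector_derivative_continuous) auto
  qed (use deriv zero in \<open>auto simp: \<close>, metis)
  then have "I x = I 0" using has_integral_unique[OF _ has_integral_0] by fastforce
  then show ?thesis by (simp add: I_def scaleR_conv_of_real)
qed

lemma hankel_symbol_inverse:
  assumes "pi / 2 < th" "th < pi"
  shows "hankel_symbol th (-1) (norm a) (\<lambda>z. inverse z *\<^sub>C a)"
proof
  show "holo_on (\<lambda>z. inverse z *\<^sub>C a) (closed_sector th)"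
    by (rule holo_on_cscale[OF holo_on_const, where g' = "\<lambda>z. - (inverse z * inverse z)"])
       (auto simp: closed_sector_def intro!: derivative_eq_intros continuous_intros)
qed (use assms in \<open>auto simp: norm_cscale norm_inverse powr_minus\<close>)

text \<open>On an arc the Jacobian cancels 1/z and leaves i times the integral of exp(N s e^(i ph)).
  Over the full circle that is 2 pi i; the two missing pieces lie where cos \<le> cos th < 0 and die
  out exponentially as N grows.\<close>

lemma hankel_exp_over:
  assumes th: "pi / 2 < th" "th < pi" and s: "s > 0"
  shows "hankel_symbol.F th (\<lambda>z. inverse z *\<^sub>C a) s = (2 * of_real pi * \<i>) *\<^sub>C a"
proof -
  interpret hankel_symbol th "-1" "norm a" "\<lambda>z. inverse z *\<^sub>C a"
    by (rule hankel_symbol_inverse[OF th])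
  define J where "J x l u = integral {l..u} (\<lambda>ph. exp (of_real x * cis ph))" for x l u :: real
  have int: "(\<lambda>ph. exp (of_real x * cis ph)) integrable_on {l..u}" for x l u
    by (intro integrable_continuous_interval continuous_intros)
  have arc: "arc_integral th (f s) N = (\<i> * J (N * s) (- th) th) *\<^sub>C a" if "N > 0" for N
  proof -
    have "arc_integral th (f s) N = integral {- th..th} (\<lambda>ph. (\<i> * exp (of_real (N * s) * cis ph)) *\<^sub>C a)"
      unfolding arc_integral_def f_def
    proof (rule integral_cong)
      fix ph
      define z where "z = of_real N * cis ph"
      have "z \<noteq> 0" using that by (simp add: z_def)
      have "\<i> * cis ph * of_real N = \<i> * z" "of_real (N * s) * cis ph = z * of_real s"
        by (simp_all add: z_def)
      moreover have "\<i> * z * (exp (z * of_real s) * inverse z) = \<i> * exp (z * of_real s)"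
        using \<open>z \<noteq> 0\<close> by simp
      ultimately show "(\<i> * cis ph * of_real N) *\<^sub>C exp (of_real N * cis ph * of_real s) *\<^sub>C inverse (of_real N * cis ph) *\<^sub>C a
          = (\<i> * exp (of_real (N * s) * cis ph)) *\<^sub>C a"
        unfolding cscale_cscale by (simp only: z_def[symmetric])
    qed
    also have "\<dots> = integral {- th..th} (\<lambda>ph. \<i> * exp (of_real (N * s) * cis ph)) *\<^sub>C a"
      using integral_linear[OF _ cscale.bounded_linear_left[of a], of "\<lambda>ph. \<i> * exp (of_real (N * s) * cis ph)" "{- th..th}"]
      by (simp add: o_def integrable_on_mult_right int del: of_real_mult)
    finally show ?thesis by (simp add: J_def)
  qed
  have small: "norm (J x l u) \<le> 2 * pi * exp (- c * x)"
    if x: "x \<ge> 0" and lu: "l \<le> u" "u - l \<le> 2 * pi" "\<And>ph. ph \<in> {l..u} \<Longrightarrow> cos ph \<le> cos th" for x l u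
  proof -
    have "norm (J x l u) \<le> exp (- c * x) * measure lborel {l..u}"
      unfolding J_def
    proof (rule has_integral_bound_real[OF _ _ integrable_integral[OF int], of _ "{}"])
      fix ph assume "ph \<in> {l..u} - {}"
      then show "norm (exp (of_real x * cis ph)) \<le> exp (- c * x)"
        using lu(3)[of ph] x by (auto simp: c_def mult.commute intro: mult_left_mono)
    qed auto
    also have "\<dots> \<le> exp (- c * x) * (2 * pi)" using lu by (intro mult_left_mono) auto
    finally show ?thesis by (simp add: mult_ac)
  qed
  have bnd: "norm (J x (- th) th - 2 * of_real pi) \<le> 4 * pi * exp (- c * x)" if "x \<ge> 0" for x
  proof -
    have "J x (- pi) (- th) + J x (- th) pi = J x (- pi) pi"
      "J x (- th) th + J x th pi = J x (- th) pi"
      unfolding J_def using th th_nonneg by (intro Henstock_Kurzweil_Integration.integral_combine int; simp)+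
    moreover have "J x (- pi) pi = 2 * of_real pi" unfolding J_def by (rule integral_exp_circle[OF that])
    ultimately have "J x (- th) th - 2 * of_real pi = - (J x (- pi) (- th)) - J x th pi" by (simp add: algebra_simps)
    moreover have "norm (J x (- pi) (- th)) \<le> 2 * pi * exp (- c * x)"
    proof (rule small[OF that])
      fix ph assume "ph \<in> {- pi..- th}"
      then have "cos (- ph) \<le> cos th" using th_nonneg by (intro cos_monotone_0_pi_le) auto
      then show "cos ph \<le> cos th" by simp
    qed (use th th_nonneg in auto)
    moreover have "norm (J x th pi) \<le> 2 * pi * exp (- c * x)"
      by (rule small[OF that]) (use th th_nonneg in \<open>auto intro!: cos_monotone_0_pi_le\<close>)
    ultimately show ?thesis
      using norm_triangle_ineq4[of "- (J x (- pi) (- th))" "J x th pi"] by simp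
  qed
  \<comment> \<open>At radius \<open>Suc n\<close> the error factor is a power of exp(-c s) < 1, so
    a geometric limit suffices.\<close>
  have "(\<lambda>n. exp (- (c * s)) ^ Suc n) \<longlonglongrightarrow> 0"
    using c_pos s by (intro LIMSEQ_Suc LIMSEQ_realpow_zero) auto
  moreover have "exp (- (c * s)) ^ Suc n = exp (- c * (real (Suc n) * s))" for n
    unfolding exp_of_nat_mult[symmetric] by (simp only: mult_ac mult_minus_left mult_minus_right)
  ultimately have "(\<lambda>n. exp (- c * (real (Suc n) * s))) \<longlonglongrightarrow> 0" by (simp only:)
  then have "(\<lambda>n. 4 * pi * exp (- c * (real (Suc n) * s))) \<longlonglongrightarrow> 0"
    by (rule tendsto_mult_right_zero)
  then have "(\<lambda>n. J (real (Suc n) * s) (- th) th - 2 * of_real pi) \<longlonglongrightarrow> 0"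
    by (rule Lim_null_comparison[OF always_eventually, rotated]) (use bnd s in \<open>simp del: of_nat_Suc\<close>)
  then have "(\<lambda>n. J (real (Suc n) * s) (- th) th) \<longlonglongrightarrow> 2 * of_real pi" by (rule LIM_zero_cancel)
  then have "(\<lambda>n. (\<i> * J (real (Suc n) * s) (- th) th) *\<^sub>C a) \<longlonglongrightarrow> (\<i> * (2 * of_real pi)) *\<^sub>C a"
    by (intro cscale.tendsto tendsto_intros)
  then have "(\<lambda>n. arc_integral th (f s) (real (Suc n))) \<longlonglongrightarrow> (\<i> * (2 * of_real pi)) *\<^sub>C a"
    by (simp add: arc del: of_nat_Suc)
  from LIMSEQ_unique[OF arc_integral_tendsto_F[OF s] this] show ?thesis by (simp add: mult_ac)
qed

section \<open>The fractional integral of an exponential\<close>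

text \<open>Substituting x = (t - s)^al absorbs the weight of the fractional integral, which is
  singular at s = t for \<open>al < 1\<close>, and leaves a continuous integrand. The antiderivative
  is only needed to be differentiable in the open interval.\<close>

lemma has_integral_powr_substitution:
  fixes f :: "real \<Rightarrow> 'a::banach"
  assumes f: "continuous_on {0..t} f" and al: "al > 0" and t: "t > 0"
  shows "((\<lambda>s. (t - s) powr (al - 1) *\<^sub>R f s) has_integral
      (1 / al) *\<^sub>R integral {0..t powr al} (\<lambda>x. f (t - x powr (1 / al)))) {0..t}"
proof -
  define T where "T = t powr al"
  define k where "k x = f (t - x powr (1 / al))" for x
  define Psi where "Psi y = integral {0..y} k" for y
  \<comment> \<open>The minus sign appears because x = (t - s)^al decreases in s; \<open>Phi\<close>
    vanishes at s = t.\<close>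
  define Phi where "Phi s = - ((1 / al) *\<^sub>R Psi ((t - s) powr al))" for s
  have range: "t - x powr (1 / al) \<in> {0..t}" if "x \<in> {0..T}" for x
  proof -
    have "x powr (1 / al) \<le> T powr (1 / al)" using that al by (intro powr_mono2) auto
    then show ?thesis using t al by (simp add: T_def powr_powr)
  qed
  have contk: "continuous_on {0..T} k"
    unfolding k_def
    by (rule continuous_on_compose2[OF f]) (use al range in \<open>auto intro!: continuous_intros continuous_on_powr'\<close>)
  have contPsi: "continuous_on {0..T} Psi"
    unfolding Psi_def by (intro indefinite_integral_continuous_1 integrable_continuous_interval contk)
  have arg: "(t - s) powr al \<in> {0..T}" if "s \<in> {0..t}" for s
    using that al by (auto simp: T_def intro!: powr_mono2)
  have "((\<lambda>s. (t - s) powr (al - 1) *\<^sub>R f s) has_integral (Phi t - Phi 0)) {0..t}"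
  proof (rule fundamental_theorem_of_calculus_interior)
    show "continuous_on {0..t} Phi"
      unfolding Phi_def
      by (intro continuous_intros continuous_on_compose2[OF contPsi] continuous_on_powr')
         (use al arg in auto)
  next
    fix s assume s: "s \<in> {0<..<t}"
    let ?y = "(t - s) powr al"
    have y: "?y \<in> {0<..<T}" using s al by (auto simp: T_def intro!: powr_less_mono2)
    have "(Psi has_vector_derivative k ?y) (at ?y within {0..T})"
      unfolding Psi_def by (rule integral_has_vector_derivative[OF contk]) (use y in auto)
    moreover have "at ?y within {0..T} = at ?y" using y by (intro at_within_interior) auto
    ultimately have Psi': "(Psi has_vector_derivative k ?y) (at ?y)" by simp
    have "((\<lambda>s. (t - s) powr al) has_vector_derivative - (al * (t - s) powr (al - 1))) (at s)"
      using s by (auto intro!: derivative_eq_intros simp flip: has_real_derivative_iff_has_vector_derivative)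
    from vector_diff_chain_at[OF this Psi']
    have "((\<lambda>s. Psi ((t - s) powr al)) has_vector_derivative - (al * (t - s) powr (al - 1)) *\<^sub>R k ?y) (at s)"
      by (simp add: o_def)
    then have "(Phi has_vector_derivative - ((1 / al) *\<^sub>R (- (al * (t - s) powr (al - 1)) *\<^sub>R k ?y))) (at s)"
      unfolding Phi_def
      by (intro has_vector_derivative_minus bounded_linear.has_vector_derivative[OF bounded_linear_scaleR_right])
    moreover have "k ?y = f s" using s al by (simp add: k_def powr_powr)
    ultimately show "(Phi has_vector_derivative (t - s) powr (al - 1) *\<^sub>R f s) (at s)"
      using al by simp
  qed (use t in simp)
  moreover have "Phi t - Phi 0 = (1 / al) *\<^sub>R integral {0..T} k"
    using al by (simp add: Phi_def Psi_def T_def)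
  ultimately show ?thesis by (simp add: T_def k_def[abs_def])
qed

lemma integral_Gamma_tendsto:
  fixes al :: real
  assumes "al > 0"
  shows "((\<lambda>X. integral {0..X} (\<lambda>u. u powr (al - 1) / exp u)) \<longlongrightarrow> Gamma al) at_top"
proof (rule tendstoI)
  fix e :: real assume "e > 0"
  let ?g = "\<lambda>u::real. u powr (al - 1) / exp u"
  obtain B where B: "B > 0" "\<And>a b. ball 0 B \<subseteq> cbox a b \<Longrightarrow>
      norm (integral (cbox a b) (\<lambda>x. if x \<in> {0..} then ?g x else 0) - Gamma al) < e"
    using Gamma_integral_real[OF assms] \<open>e > 0\<close> unfolding has_integral_alt' by blast
  have "dist (integral {0..X} ?g) (Gamma al) < e" if "X \<ge> B" for X
  proof -
    have "norm (integral (cbox (- X) X) (\<lambda>x. if x \<in> {0..} then ?g x else 0) - Gamma al) < e"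
      by (rule B(2)) (use that in \<open>auto simp: dist_real_def\<close>)
    also have "integral (cbox (- X) X) (\<lambda>x. if x \<in> {0..} then ?g x else 0) = integral ({0..} \<inter> cbox (- X) X) ?g"
      by (rule integral_restrict_Int)
    also have "{0..} \<inter> cbox (- X) X = {0..X}" using B(1) that by auto
    finally show ?thesis by (simp add: dist_norm)
  qed
  then show "\<forall>\<^sub>F X in at_top. dist (integral {0..X} ?g) (Gamma al) < e"
    unfolding eventually_at_top_linorder by blast
qed

lemma cmod_powr_of_real: "cmod (z powr of_real a) = cmod z powr a"
  by (simp add: norm_powr_real_powr')

lemma closed_sector_nonpos_Reals:
  assumes "z \<in> closed_sector th" "th < pi" shows "z \<notin> \<real>\<^sub>\<le>\<^sub>0"
proof
  assume "z \<in> \<real>\<^sub>\<le>\<^sub>0"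
  obtain r ph where z: "z = of_real r * cis ph" "r > 0" "\<bar>ph\<bar> \<le> th"
    using assms(1) unfolding closed_sector_def by blast
  have ph: "- pi < ph" "ph < pi" using z(3) assms(2) by auto
  have "sin ph = 0" using \<open>z \<in> \<real>\<^sub>\<le>\<^sub>0\<close> z by (auto simp: complex_nonpos_Reals_iff)
  then have "ph = 0" using ph sin_gt_zero[of ph] sin_gt_zero[of "- ph"] by (cases ph "0::real" rule: linorder_cases) auto
  then show False using \<open>z \<in> \<real>\<^sub>\<le>\<^sub>0\<close> z by (auto simp: complex_nonpos_Reals_iff)
qed

text \<open>A horizontal ray to the right of z keeps a distance proportional to |z| from the origin.
  In the right half-plane the modulus does not decrease; in the left one the unchanged imaginary
  part is already at least |z| sin th, as the angle lies between pi/2 and \<open>th\<close>.\<close>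

lemma closed_sector_add_of_real:
  assumes z: "z \<in> closed_sector th" and th: "pi / 2 < th" "th < pi" and x: "x \<ge> 0"
  shows "cmod z * sin th \<le> cmod (z + of_real x)"
proof -
  obtain r ph where z: "z = of_real r * cis ph" "r > 0" "\<bar>ph\<bar> \<le> th"
    using assms(1) unfolding closed_sector_def by blast
  have s: "0 \<le> sin th" "sin th \<le> 1" using th pi_gt_zero by (auto intro!: sin_ge_zero)
  show ?thesis
  proof (cases "cos ph \<ge> 0")
    case True
    have "(Re z)\<^sup>2 \<le> (Re (z + of_real x))\<^sup>2" using True x z by (intro power_mono) auto
    then have 1: "cmod z \<le> cmod (z + of_real x)" unfolding norm_complex_def by (intro real_sqrt_le_mono) simp
    have "cmod z * sin th \<le> cmod z" using s by (simp add: mult_left_le)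
    also note 1
    finally show ?thesis .
  next
    case False
    have p2: "pi / 2 \<le> \<bar>ph\<bar>"
    proof (rule ccontr)
      assume "\<not> pi / 2 \<le> \<bar>ph\<bar>"
      then have "cos ph \<ge> 0" by (intro cos_ge_zero) auto
      with False show False by simp
    qed
    have "sin (pi - th) \<le> sin (pi - \<bar>ph\<bar>)"
      using th z(3) p2 by (intro sin_monotone_2pi_le) auto
    then have "sin th \<le> sin \<bar>ph\<bar>" by simp
    also have "\<dots> \<le> \<bar>sin ph\<bar>" by (auto simp: abs_if)
    finally have "cmod z * sin th \<le> r * \<bar>sin ph\<bar>" using z by (simp add: norm_mult mult_left_mono)
    also have "\<dots> = \<bar>Im (z + of_real x)\<bar>" using z by (simp add: abs_mult)
    also have "\<dots> \<le> cmod (z + of_real x)" by (rule abs_Im_le_cmod)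
    finally show ?thesis .
  qed
qed

text \<open>Up to the factor \<open>exp (z t) z\<^sup>-\<^sup>\<alpha>\<close> this is the fractional integral of order \<open>\<alpha>\<close> of
  \<open>s \<mapsto> exp (z s)\<close> at \<open>t\<close>, after the substitution \<open>x = (t - s)\<^sup>\<alpha>\<close>.\<close>
definition inc_gamma_kernel :: "real \<Rightarrow> real \<Rightarrow> complex \<Rightarrow> complex" where
  "inc_gamma_kernel al t z = z powr of_real al / of_real (al * Gamma al) *
     integral {0..t powr al} (\<lambda>x. exp (- (z * of_real (x powr (1 / al)))))"

context
  fixes al t :: real
  assumes al: "0 < al" "al < 1" and t: "0 < t"
begin

lemma continuous_on_root: "continuous_on {0..b} (\<lambda>x. x powr (1 / al))"
  using al by (intro continuous_on_powr') auto

text \<open>The kernel is the regularised lower incomplete gamma function P(\<alpha>, z t), whence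
  the derivative. It is obtained by differentiating under the integral and eliminating the new
  integral \<open>Q1\<close> through integration by parts.\<close>

lemma kernel_has_field_derivative:
  assumes z: "z \<notin> \<real>\<^sub>\<le>\<^sub>0"
  shows "(inc_gamma_kernel al t has_field_derivative
    of_real (t powr al / Gamma al) * z powr (of_real al - 1) * exp (- (z * of_real t))) (at z)"
proof -
  define T where "T = t powr al"
  define u where "u x = x powr (1 / al)" for x
  have T: "T > 0" "u T = t" using al t by (simp_all add: T_def u_def powr_powr)
  have G: "Gamma al > 0" using al by (simp add: Gamma_real_pos)
  have contu: "continuous_on (cbox 0 T) u" unfolding u_def cbox_interval by (rule continuous_on_root)
  define Q where "Q z = integral (cbox 0 T) (\<lambda>x. exp (- (z * of_real (u x))))" for z :: complex
  define Q1 where "Q1 z = integral (cbox 0 T) (\<lambda>x. of_real (u x) * exp (- (z * of_real (u x))))" for z :: complex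
  have "(Q has_field_derivative integral (cbox 0 T) (\<lambda>x. - (of_real (u x) * exp (- (z * of_real (u x)))))) (at z within UNIV)"
    unfolding Q_def
  proof (rule leibniz_rule_field_derivative)
    fix z :: complex and x :: real
    show "((\<lambda>z. exp (- (z * of_real (u x)))) has_field_derivative - (of_real (u x) * exp (- (z * of_real (u x))))) (at z within UNIV)"
      by (auto intro!: derivative_eq_intros)
  next
    fix z :: complex
    show "(\<lambda>x. exp (- (z * of_real (u x)))) integrable_on cbox 0 T"
      by (intro integrable_continuous continuous_intros contu)
  next
    show "continuous_on (UNIV \<times> cbox 0 T) (\<lambda>(z, x). - (complex_of_real (u x) * exp (- (z * of_real (u x)))))"
      unfolding case_prod_unfold
      by (intro continuous_intros continuous_on_compose2[OF contu continuous_on_snd]) auto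
  qed auto
  then have Q': "(Q has_field_derivative - Q1 z) (at z)"
    by (simp add: Q1_def)
  \<comment> \<open>Integration by parts, using x u'(x) = u(x)/al for u(x) = x^(1/al).\<close>
  have "((\<lambda>x. exp (- (z * of_real (u x))) - z / of_real al * (of_real (u x) * exp (- (z * of_real (u x))))) has_integral
      of_real T * exp (- (z * of_real (u T))) - of_real 0 * exp (- (z * of_real (u 0)))) {0..T}"
  proof (rule fundamental_theorem_of_calculus_interior)
    show "continuous_on {0..T} (\<lambda>x. of_real x * exp (- (z * of_real (u x))))"
      using contu by (intro continuous_intros) auto
    fix x assume x: "x \<in> {0<..<T}"
    have "(u has_real_derivative (1 / al) * x powr (1 / al - 1)) (at x)"
      unfolding u_def using x by (auto intro!: derivative_eq_intros)
    then have u': "((\<lambda>x. complex_of_real (u x)) has_vector_derivative of_real ((1 / al) * x powr (1 / al - 1))) (at x)"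
      by (simp only: has_real_derivative_iff_has_vector_derivative has_vector_derivative_of_real)
    have "((\<lambda>w. exp (- (z * w))) has_field_derivative - z * exp (- (z * of_real (u x)))) (at (of_real (u x)))"
      by (auto intro!: derivative_eq_intros)
    from field_vector_diff_chain_at[OF u' this]
    have e': "((\<lambda>x. exp (- (z * of_real (u x)))) has_vector_derivative
        of_real ((1 / al) * x powr (1 / al - 1)) * (- z * exp (- (z * of_real (u x))))) (at x)"
      unfolding o_def .
    have "((\<lambda>x. complex_of_real x) has_vector_derivative 1) (at x)"
      by (auto intro!: derivative_eq_intros)
    from has_vector_derivative_mult[OF this e']
    have "((\<lambda>x. of_real x * exp (- (z * of_real (u x)))) has_vector_derivative
      of_real x * (of_real ((1 / al) * x powr (1 / al - 1)) * (- z * exp (- (z * of_real (u x)))))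
       + 1 * exp (- (z * of_real (u x)))) (at x)" .
    moreover have "u x = x * x powr (1 / al - 1)"
      using x by (simp add: u_def powr_diff)
    ultimately show "((\<lambda>x. of_real x * exp (- (z * of_real (u x)))) has_vector_derivative
        exp (- (z * of_real (u x))) - z / of_real al * (of_real (u x) * exp (- (z * of_real (u x))))) (at x)"
      by (simp add: mult_ac)
  qed (use T in simp)
  moreover have "integral {0..T} (\<lambda>x. exp (- (z * of_real (u x))) - z / of_real al * (of_real (u x) * exp (- (z * of_real (u x)))))
      = Q z - z / of_real al * Q1 z"
    unfolding Q_def Q1_def cbox_interval integral_mult_right[symmetric] using contu
    by (intro Henstock_Kurzweil_Integration.integral_diff integrable_continuous_interval continuous_intros) auto
  ultimately have "Q z - z / of_real al * Q1 z = of_real T * exp (- (z * of_real t))"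
    by (simp add: integral_unique T)
  then have eq: "of_real al * Q z - z * Q1 z = of_real al * of_real T * exp (- (z * of_real t))"
    using al by (simp add: field_simps)
  have "z \<noteq> 0" using z by auto
  then have zz: "z powr of_real al = z powr (of_real al - 1) * z" by (simp add: powr_diff)
  have "((\<lambda>z. z powr of_real al / of_real (al * Gamma al) * Q z) has_field_derivative
     (of_real al * z powr (of_real al - 1)) / of_real (al * Gamma al) * Q z + (- Q1 z) * (z powr of_real al / of_real (al * Gamma al))) (at z)"
    by (rule DERIV_mult[OF DERIV_cdivide[OF has_field_derivative_powr[OF z]] Q'])
  also have "(of_real al * z powr (of_real al - 1)) / of_real (al * Gamma al) * Q z + (- Q1 z) * (z powr of_real al / of_real (al * Gamma al))
    = z powr (of_real al - 1) / of_real (al * Gamma al) * (of_real al * Q z - z * Q1 z)"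
    unfolding zz by (simp add: algebra_simps diff_divide_distrib)
  also have "\<dots> = of_real (T / Gamma al) * z powr (of_real al - 1) * exp (- (z * of_real t))"
    unfolding eq using al G by (simp add: field_simps)
  finally show ?thesis
    unfolding inc_gamma_kernel_def[abs_def] Q_def T_def u_def cbox_interval .
qed

text \<open>On the positive axis the integral becomes, by real substitutions, a truncation of
  Euler's integral for \<open>Gamma al\<close>; this is where the normalisation of the limit to 1
  comes from.\<close>

lemma kernel_of_real:
  assumes x: "x > 0"
  shows "inc_gamma_kernel al t (of_real x) =
    of_real (integral {0..x * t} (\<lambda>u. u powr (al - 1) / exp u) / Gamma al)"
proof -
  let ?g = "\<lambda>u::real. u powr (al - 1) / exp u"
  define I where "I = integral {0..x * t} ?g"
  have G: "Gamma al > 0" using al by (simp add: Gamma_real_pos)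
  have "?g integrable_on {0..x * t}"
    using integrable_on_subinterval[OF has_integral_integrable[OF Gamma_integral_real[OF al(1)]], of 0 "x * t"] by auto
  then have "(?g has_integral I) (cbox 0 (x * t))" unfolding I_def by (simp add: integrable_integral)
  \<comment> \<open>The change of variable u = x (t - s); after it
    \<open>has_integral_powr_substitution\<close> identifies the same integral a second
    time.\<close>
  from has_integral_affinity[OF this, of "- x" "x * t"]
  have "((\<lambda>s. ?g (x * (t - s))) has_integral I / x) ((\<lambda>y. t - y / x) ` {0..x * t})"
    using x by (simp add: algebra_simps)
  moreover have "(\<lambda>y. t - y / x) ` {0..x * t} = {0..t}"
  proof (intro equalityI subsetI)
    fix s assume "s \<in> {0..t}"
    then show "s \<in> (\<lambda>y. t - y / x) ` {0..x * t}"
      using x by (intro image_eqI[of _ _ "x * (t - s)"]) (auto simp: mult_left_mono)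
  qed (use x in \<open>auto simp: field_simps\<close>)
  ultimately have "((\<lambda>s. ?g (x * (t - s))) has_integral I / x) {0..t}" by simp
  from has_integral_mult_right[OF this, of "x powr (1 - al)"]
  have "((\<lambda>s. x powr (1 - al) * ?g (x * (t - s))) has_integral x powr (- al) * I) {0..t}"
    using x by (simp add: powr_diff powr_minus divide_simps)
  moreover have "x powr (1 - al) * ?g (x * (t - s)) = (t - s) powr (al - 1) *\<^sub>R exp (- (x * (t - s)))" if "s \<in> {0..t}" for s
    using x that by (simp add: powr_mult powr_diff exp_minus divide_simps)
  ultimately have 1: "((\<lambda>s. (t - s) powr (al - 1) *\<^sub>R exp (- (x * (t - s)))) has_integral x powr (- al) * I) {0..t}"
    by (rule has_integral_eq[rotated])
  have "((\<lambda>s. (t - s) powr (al - 1) *\<^sub>R exp (- (x * (t - s)))) has_integral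
      (1 / al) *\<^sub>R integral {0..t powr al} (\<lambda>y. exp (- (x * (t - (t - y powr (1 / al))))))) {0..t}"
    by (rule has_integral_powr_substitution) (use al t in \<open>auto intro!: continuous_intros\<close>)
  from has_integral_unique[OF this 1]
  have Q: "integral {0..t powr al} (\<lambda>y. exp (- (x * y powr (1 / al)))) = al * x powr (- al) * I"
    using al by (simp add: field_simps)
  have "integral {0..t powr al} (\<lambda>y. exp (- (of_real x * complex_of_real (y powr (1 / al)))))
      = integral {0..t powr al} (\<lambda>y. of_real (exp (- (x * y powr (1 / al)))))"
    by (simp flip: exp_of_real)
  also have "\<dots> = of_real (integral {0..t powr al} (\<lambda>y. exp (- (x * y powr (1 / al)))))"
    using integral_linear[OF _ bounded_linear_of_real[where 'a = complex], of "\<lambda>y. exp (- (x * y powr (1 / al)))" "{0..t powr al}"]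
    by (simp add: o_def integrable_continuous_interval continuous_intros continuous_on_root)
  finally show ?thesis
    unfolding inc_gamma_kernel_def I_def[symmetric] using x al G
    by (simp add: Q powr_of_real powr_minus field_simps)
qed

lemma kernel_tendsto_of_real: "((\<lambda>x. inc_gamma_kernel al t (of_real x)) \<longlongrightarrow> 1) at_top"
proof -
  have G: "Gamma al > 0" using al by (simp add: Gamma_real_pos)
  have "filterlim (\<lambda>x. x * t) at_top at_top"
    using t by (intro filterlim_at_top_mult_tendsto_pos[OF tendsto_const] filterlim_ident)
  then have "((\<lambda>x. integral {0..x * t} (\<lambda>u. u powr (al - 1) / exp u)) \<longlongrightarrow> Gamma al) at_top"
    by (rule filterlim_compose[OF integral_Gamma_tendsto[OF al(1)]])
  then have "((\<lambda>x. of_real (integral {0..x * t} (\<lambda>u. u powr (al - 1) / exp u) / Gamma al)) \<longlongrightarrow> complex_of_real (Gamma al / Gamma al)) at_top"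
    using G by (intro tendsto_intros) auto
  moreover have "\<forall>\<^sub>F x in at_top. of_real (integral {0..x * t} (\<lambda>u. u powr (al - 1) / exp u) / Gamma al) = inc_gamma_kernel al t (of_real x)"
    using eventually_gt_at_top[of "0::real"] by eventually_elim (simp add: kernel_of_real)
  ultimately show ?thesis using G by (auto intro: Lim_transform_eventually)
qed

text \<open>The limit is known on the real axis, and z + x is compared with its real part: far to
  the right the derivative is exponentially small while the distance stays |Im z|.\<close>

lemma kernel_tendsto: "((\<lambda>x. inc_gamma_kernel al t (z + of_real x)) \<longlongrightarrow> 1) at_top"
proof -
  have G: "Gamma al > 0" using al by (simp add: Gamma_real_pos)
  let ?P = "inc_gamma_kernel al t" and ?B = "\<lambda>y. t powr al / Gamma al * exp (- (y * t))"
  have shift: "filterlim (\<lambda>x. Re z + x) at_top at_top"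
    by (intro filterlim_tendsto_add_at_top[OF tendsto_const] filterlim_ident)
  have bnd: "norm (?P (z + of_real x) - ?P (of_real (Re z + x))) \<le> ?B (Re z + x) * \<bar>Im z\<bar>" if x: "Re z + x \<ge> 1" for x
  proof -
    \<comment> \<open>A convex set containing both points. On it |w| \<ge> 1, which removes the
      power |w|^(al - 1), and Re w \<ge> Re z + x controls the exponential.\<close>
    let ?S = "{w. Re w \<ge> Re z + x}"
    have "norm (?P (z + of_real x) - ?P (of_real (Re z + x))) \<le> ?B (Re z + x) * norm (z + of_real x - of_real (Re z + x))"
    proof (rule field_differentiable_bound)
      show "convex ?S" by (rule convex_halfspace_Re_ge)
      fix w assume w: "w \<in> ?S"
      then have "w \<notin> \<real>\<^sub>\<le>\<^sub>0" using x by (auto simp: complex_nonpos_Reals_iff)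
      then show "(?P has_field_derivative of_real (t powr al / Gamma al) * w powr (of_real al - 1) * exp (- (w * of_real t))) (at w within ?S)"
        by (rule has_field_derivative_at_within[OF kernel_has_field_derivative])
      have "cmod w \<ge> 1" using w x complex_Re_le_cmod[of w] by auto
      then have "cmod w powr (al - 1) \<le> cmod w powr 0" using al by (intro powr_mono) auto
      then have "cmod (w powr (of_real al - 1)) \<le> 1"
        using \<open>cmod w \<ge> 1\<close> cmod_powr_of_real[of w "al - 1"] by (auto split: if_splits)
      moreover have "cmod (exp (- (w * of_real t))) \<le> exp (- ((Re z + x) * t))"
        using w t by (simp add: mult_right_mono)
      ultimately have "cmod (w powr (of_real al - 1)) * cmod (exp (- (w * of_real t))) \<le> 1 * exp (- ((Re z + x) * t))"
        by (intro mult_mono) auto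
      then show "norm (of_real (t powr al / Gamma al) * w powr (of_real al - 1) * exp (- (w * of_real t))) \<le> ?B (Re z + x)"
        unfolding norm_mult mult.assoc using G by (intro mult_mono) (auto simp: norm_divide)
    qed auto
    also have "z + of_real x - of_real (Re z + x) = \<i> * of_real (Im z)"
      by (simp add: complex_eq_iff)
    finally show ?thesis by (simp add: norm_mult)
  qed
  have "filterlim (\<lambda>x. (Re z + x) * t) at_top at_top"
    using t by (intro filterlim_at_top_mult_tendsto_pos[OF tendsto_const] shift)
  then have "((\<lambda>x. exp (- ((Re z + x) * t))) \<longlongrightarrow> 0) at_top"
    by (intro filterlim_compose[OF exp_at_bot] filterlim_compose[OF filterlim_uminus_at_bot_at_top])
  then have "((\<lambda>x. ?B (Re z + x) * \<bar>Im z\<bar>) \<longlongrightarrow> 0) at_top"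
    by (intro tendsto_mult_left_zero tendsto_mult_right_zero)
  moreover have "\<forall>\<^sub>F x in at_top. norm (?P (z + of_real x) - ?P (of_real (Re z + x))) \<le> ?B (Re z + x) * \<bar>Im z\<bar>"
    using eventually_ge_at_top[of "1 - Re z"] by eventually_elim (rule bnd, simp)
  ultimately have "((\<lambda>x. ?P (z + of_real x) - ?P (of_real (Re z + x))) \<longlongrightarrow> 0) at_top"
    by (rule Lim_null_comparison[rotated])
  from tendsto_add[OF this filterlim_compose[OF kernel_tendsto_of_real shift]] show ?thesis
    by simp
qed

text \<open>The derivative of the kernel is integrated from \<open>z\<close> to infinity along a horizontal
  ray, which stays away from the branch cut.\<close>
lemma kernel_bound:
  assumes z: "z \<in> closed_sector th" and th: "pi / 2 < th" "th < pi"
  shows "cmod (1 - inc_gamma_kernel al t z) \<le>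
    t powr al / Gamma al * (cmod z * sin th) powr (al - 1) * exp (- (Re z * t)) / t"
proof -
  have G: "Gamma al > 0" using al by (simp add: Gamma_real_pos)
  let ?P = "inc_gamma_kernel al t"
  define B where "B = t powr al / Gamma al * (cmod z * sin th) powr (al - 1) * exp (- (Re z * t))"
  have B: "B \<ge> 0" using G by (simp add: B_def)
  have "sin th > 0" using th pi_gt_zero by (intro sin_gt_zero) auto
  moreover have "z \<noteq> 0" using closed_sector_nonpos_Reals[OF z th(2)] by auto
  ultimately have m: "cmod z * sin th > 0" by simp
  have nz: "z + of_real x \<notin> \<real>\<^sub>\<le>\<^sub>0" if "x \<ge> 0" for x
    using closed_sector_nonpos_Reals[OF z th(2)] that by (auto simp: complex_nonpos_Reals_iff)
  have step: "cmod (?P (z + of_real b) - ?P z) \<le> B / t" if "b > 0" for b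
  proof -
    have deriv: "((\<lambda>x. ?P (z + of_real x)) has_vector_derivative
        of_real (t powr al / Gamma al) * (z + of_real x) powr (of_real al - 1) * exp (- ((z + of_real x) * of_real t))) (at x)"
      if "x \<ge> 0" for x
    proof -
      have "((\<lambda>x. z + of_real x) has_vector_derivative 1) (at x)"
        by (auto intro!: derivative_eq_intros)
      from field_vector_diff_chain_at[OF this kernel_has_field_derivative[OF nz[OF that]]]
      show ?thesis by (simp add: o_def)
    qed
    \<comment> \<open>The majorant B e^(-x t) has the primitive -(B/t) e^(-x t), whose total
      increase is at most B/t whatever \<open>b\<close> is. \<open>B\<close> keeps the factor
      exp(-Re z t), which later compensates the growth of exp(z t).\<close>
    have "norm (?P (z + of_real b) - ?P (z + of_real 0)) \<le> - (B / t * exp (- (b * t))) - - (B / t * exp (- (0 * t)))"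
    proof (rule differentiable_bound_general[where f = "\<lambda>x. ?P (z + of_real x)" and \<phi> = "\<lambda>x. - (B / t * exp (- (x * t)))"
          and \<phi>' = "\<lambda>x. B * exp (- (x * t))"])
      show "continuous_on {0..b} (\<lambda>x. ?P (z + of_real x))"
        using deriv by (intro continuous_at_imp_continuous_on ballI has_vector_derivative_continuous) auto
      fix x assume x: "0 < x" "x < b"
      show "((\<lambda>x. ?P (z + of_real x)) has_vector_derivative
        of_real (t powr al / Gamma al) * (z + of_real x) powr (of_real al - 1) * exp (- ((z + of_real x) * of_real t))) (at x)"
        using deriv x by simp
      show "((\<lambda>x. - (B / t * exp (- (x * t)))) has_vector_derivative B * exp (- (x * t))) (at x)"
        using t by (auto intro!: derivative_eq_intros simp flip: has_real_derivative_iff_has_vector_derivative)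
      have "cmod ((z + of_real x) powr (of_real al - 1)) = cmod (z + of_real x) powr (al - 1)"
        using cmod_powr_of_real[of _ "al - 1"] by simp
      also have "\<dots> \<le> (cmod z * sin th) powr (al - 1)"
        using m al closed_sector_add_of_real[OF z th, of x] x by (intro powr_mono2') auto
      finally have "cmod ((z + of_real x) powr (of_real al - 1)) * cmod (exp (- ((z + of_real x) * of_real t)))
         \<le> (cmod z * sin th) powr (al - 1) * (exp (- (Re z * t)) * exp (- (x * t)))"
        by (intro mult_mono) (auto simp: algebra_simps simp flip: exp_add)
      then have "t powr al / Gamma al * (cmod ((z + of_real x) powr (of_real al - 1)) * cmod (exp (- ((z + of_real x) * of_real t))))
         \<le> t powr al / Gamma al * ((cmod z * sin th) powr (al - 1) * (exp (- (Re z * t)) * exp (- (x * t))))"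
        using G by (intro mult_left_mono) auto
      then show "norm (of_real (t powr al / Gamma al) * (z + of_real x) powr (of_real al - 1) * exp (- ((z + of_real x) * of_real t)))
          \<le> B * exp (- (x * t))"
        using G by (simp add: norm_mult norm_divide B_def mult_ac)
    qed (use that t in \<open>auto intro!: continuous_intros\<close>)
    also have "\<dots> \<le> B / t" using B t by simp
    finally show ?thesis by simp
  qed
  have "((\<lambda>b. cmod (?P (z + of_real b) - ?P z)) \<longlongrightarrow> cmod (1 - ?P z)) at_top"
    by (intro tendsto_intros kernel_tendsto)
  then have "cmod (1 - ?P z) \<le> B / t"
    by (rule tendsto_upperbound[OF _ eventually_mono[OF eventually_gt_at_top[of 0] step]]) simp_all
  then show ?thesis by (simp add: B_def)
qed

end

section \<open>Fractional integrals of Hankel integrals\<close>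

text \<open>The majorant for fractional integrals of functions that are themselves singular at 0:
  one power for the function, one for the weight.\<close>

lemma integrable_Beta_interval:
  fixes a b t :: real
  assumes "a > 0" "b > 0" "t > 0"
  shows "(\<lambda>s. s powr (a - 1) * (t - s) powr (b - 1)) integrable_on {0..t}"
proof -
  let ?g = "\<lambda>s. s powr (a - 1) * (1 - s) powr (b - 1)"
  have "(?g has_integral Beta a b) (cbox 0 1)"
    using has_integral_Beta_real[OF assms(1,2)] by simp
  from has_integral_affinity[OF this, of "1 / t" 0]
  have "((\<lambda>s. ?g (s / t)) has_integral t * Beta a b) ((\<lambda>x. t * x) ` {0..1})"
    using assms by simp
  also have "(\<lambda>x. t * x) ` {0..1} = {0..t}"
    using assms image_mult_atLeastAtMost[of t 0 1] by simp
  finally have "(\<lambda>s. t powr (a + b - 2) * ?g (s / t)) integrable_on {0..t}"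
    by (intro integrable_on_mult_right has_integral_integrable)
  then show ?thesis
  proof (rule integrable_eq)
    fix s assume s: "s \<in> {0..t}"
    have "1 - s / t = (t - s) / t" using assms by (simp add: diff_divide_distrib)
    then have "?g (s / t) = s powr (a - 1) * (t - s) powr (b - 1) / (t powr (a - 1) * t powr (b - 1))"
      using s assms by (simp add: powr_divide)
    also have "t powr (a - 1) * t powr (b - 1) = t powr (a + b - 2)"
      by (simp flip: powr_add add: algebra_simps)
    finally show "t powr (a + b - 2) * ?g (s / t) = s powr (a - 1) * (t - s) powr (b - 1)"
      using assms by simp
  qed
qed

lemma continuous_on_arc_integrand:
  assumes "continuous_on (closed_sector th) f" "N > 0"
  shows "continuous_on {- th..th} (\<lambda>ph. (\<i> * cis ph * of_real N) *\<^sub>C f (of_real N * cis ph))"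
  by (intro continuous_intros continuous_on_compose2[OF assms(1)])
     (use assms(2) in \<open>auto intro!: closed_sectorI\<close>)

lemma arc_integral_diff:
  assumes "continuous_on (closed_sector th) f" "continuous_on (closed_sector th) g" "N > 0"
  shows "arc_integral th (\<lambda>z. f z - g z) N = arc_integral th f N - arc_integral th g N"
  unfolding arc_integral_def cscale.diff_right
  by (intro Henstock_Kurzweil_Integration.integral_diff integrable_continuous_interval
        continuous_on_arc_integrand assms)

lemma arc_integral_norm_bound:
  assumes f: "continuous_on (closed_sector th) f" and N: "N > 0" and th: "th \<ge> 0"
    and B: "\<And>ph. \<bar>ph\<bar> \<le> th \<Longrightarrow> norm (f (of_real N * cis ph)) \<le> B"
  shows "norm (arc_integral th f N) \<le> 2 * th * N * B"
proof -
  have "norm (arc_integral th f N) \<le> N * B * measure lborel {- th..th}"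
    unfolding arc_integral_def
  proof (rule has_integral_bound_real[OF _ _ integrable_integral[OF integrable_continuous_interval[OF continuous_on_arc_integrand[OF f N]]], of _ "{}"])
    have "0 \<le> B" using order_trans[OF norm_ge_zero B[of 0]] th by simp
    then show "0 \<le> N * B" using N by simp
  qed (use B N in \<open>auto simp: norm_cscale norm_mult intro!: mult_left_mono\<close>)
  then show ?thesis using th by (simp add: mult_ac)
qed

lemma integral_cscale_left:
  fixes a :: "'a::cbanach"
  shows "f integrable_on S \<Longrightarrow> integral S (\<lambda>x. f x *\<^sub>C a) = integral S f *\<^sub>C a"
  using integral_linear[OF _ cscale.bounded_linear_left[of a], of f S] by (simp add: o_def)

lemma hankel_symbol_powr:
  assumes "hankel_symbol th p C w" "p + al < 0"
  shows "hankel_symbol th (p + al) C (\<lambda>z. z powr of_real al *\<^sub>C w z)"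
proof -
  interpret hankel_symbol th p C w by fact
  show ?thesis
  proof
    show "holo_on (\<lambda>z. z powr of_real al *\<^sub>C w z) (closed_sector th)"
    proof (rule holo_on_cscale[OF holo, where g' = "\<lambda>z. of_real al * z powr (of_real al - 1)"])
      fix z assume "z \<in> closed_sector th"
      then show "((\<lambda>z. z powr of_real al) has_field_derivative of_real al * z powr (of_real al - 1)) (at z)"
        by (intro has_field_derivative_powr closed_sector_nonpos_Reals[OF _ th(2)])
    next
      have "closed_sector th \<subseteq> - \<real>\<^sub>\<le>\<^sub>0" using closed_sector_nonpos_Reals[OF _ th(2)] by auto
      then show "continuous_on (closed_sector th) (\<lambda>z. of_real al * z powr (of_real al - 1))"
        by (intro continuous_intros) (auto simp: complex_nonpos_Reals_iff subset_iff not_le)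
    qed
    fix z assume z: "z \<in> closed_sector th"
    have "norm (z powr of_real al *\<^sub>C w z) \<le> cmod z powr al * (C * cmod z powr p)"
      unfolding norm_cscale cmod_powr_of_real using bound[OF z] by (intro mult_left_mono) auto
    then show "norm (z powr of_real al *\<^sub>C w z) \<le> C * cmod z powr (p + al)"
      by (simp add: powr_add mult_ac)
  qed (use th C assms(2) in auto)
qed

context
  fixes th C al t :: real and w w' :: "complex \<Rightarrow> 'a::cbanach"
  assumes W: "hankel_symbol th (- 1) C w" and al: "0 < al" "al < 1" and t: "0 < t"
    and w': "w' = (\<lambda>z. z powr of_real al *\<^sub>C w z)"
begin

interpretation W: hankel_symbol th "- 1" C w by (fact W)

interpretation V: hankel_symbol th "al - 1" C w'
  using hankel_symbol_powr[OF W, of al] al by (simp add: w')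

text \<open>The fractional integral of order \<open>al\<close> of s -> exp(z s) at \<open>t\<close>
  (see \<open>kern_eq\<close>), factored into the main term exp(z t) z^(-al) and the factor whose
  distance from 1 \<open>kernel_bound\<close> estimates.\<close>

definition kern :: "complex \<Rightarrow> complex" where
  "kern z = exp (z * of_real t) * z powr (- of_real al) * inc_gamma_kernel al t z"

lemma kern_eq:
  assumes "z \<noteq> 0"
  shows "kern z = of_real (1 / (al * Gamma al)) *
    integral {0..t powr al} (\<lambda>x. exp (z * of_real (t - x powr (1 / al))))"
proof -
  have "integral {0..t powr al} (\<lambda>x. exp (z * of_real (t - x powr (1 / al))))
    = integral {0..t powr al} (\<lambda>x. exp (z * of_real t) * exp (- (z * of_real (x powr (1 / al)))))"
    by (simp add: algebra_simps flip: exp_add)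
  also have "\<dots> = exp (z * of_real t) * integral {0..t powr al} (\<lambda>x. exp (- (z * of_real (x powr (1 / al)))))"
    by simp
  finally show ?thesis
    using assms by (simp add: kern_def inc_gamma_kernel_def powr_minus)
qed

lemma continuous_on_kern: "continuous_on (closed_sector th) kern"
proof -
  have S: "closed_sector th \<subseteq> - \<real>\<^sub>\<le>\<^sub>0" using closed_sector_nonpos_Reals[OF _ W.th(2)] by auto
  have "continuous_on (closed_sector th) (inc_gamma_kernel al t)"
    using closed_sector_nonpos_Reals[OF _ W.th(2)]
    by (intro continuous_at_imp_continuous_on ballI DERIV_isCont[OF kernel_has_field_derivative[OF al t]])
  then show ?thesis
    unfolding kern_def[abs_def]
    using S by (intro continuous_intros) (auto simp: complex_nonpos_Reals_iff subset_iff not_le)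
qed

text \<open>At a fixed radius, and after the substitution x = (t - s)^al, the double integrand is
  continuous on a compact rectangle, so the order of integration may be exchanged.\<close>

lemma RL_int_arc:
  assumes N: "N > 0"
  shows "RL_int al (\<lambda>s. arc_integral th (V.f s) N) t = arc_integral th (\<lambda>z. kern z *\<^sub>C w' z) N"
proof -
  define T where "T = t powr al"
  define u where "u x = x powr (1 / al)" for x
  define k where "k ph = \<i> * cis ph * of_real N" for ph
  define z where "z ph = of_real N * cis ph" for ph
  have contu: "continuous_on (cbox 0 T) u" unfolding u_def cbox_interval by (rule continuous_on_root[OF al t])
  have contz: "continuous_on (cbox (- th) th) (\<lambda>ph. w' (z ph))"
    unfolding z_def
    by (intro continuous_intros continuous_on_compose2[OF holo_on_imp_continuous_on[OF V.holo]])
       (use N in \<open>auto intro!: closed_sectorI\<close>)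
  have int: "(\<lambda>x. exp (zz * of_real (t - u x))) integrable_on {0..T}" for zz :: complex
    using contu by (intro integrable_continuous_interval continuous_intros) auto
  have "integral {0..t} (\<lambda>s. (t - s) powr (al - 1) *\<^sub>R arc_integral th (V.f s) N)
      = (1 / al) *\<^sub>R integral {0..T} (\<lambda>x. arc_integral th (V.f (t - u x)) N)"
    unfolding T_def u_def
    by (intro integral_unique has_integral_powr_substitution al t continuous_on_subset[OF V.continuous_on_arc_integral[OF N]]) auto
  also have "integral {0..T} (\<lambda>x. arc_integral th (V.f (t - u x)) N)
      = integral (cbox 0 T) (\<lambda>x. integral (cbox (- th) th) (\<lambda>ph. k ph *\<^sub>C exp (z ph * of_real (t - u x)) *\<^sub>C w' (z ph)))"
    by (simp add: arc_integral_def V.f_def k_def z_def)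
  also have "\<dots> = integral (cbox (- th) th) (\<lambda>ph. integral (cbox 0 T) (\<lambda>x. k ph *\<^sub>C exp (z ph * of_real (t - u x)) *\<^sub>C w' (z ph)))"
  proof (rule integral_swap_continuous)
    show "continuous_on (cbox (0, - th) (T, th)) (\<lambda>(x, ph). k ph *\<^sub>C exp (z ph * of_real (t - u x)) *\<^sub>C w' (z ph))"
      unfolding case_prod_unfold
      by (intro continuous_intros continuous_on_compose2[OF contu continuous_on_fst] continuous_on_compose2[OF contz continuous_on_snd])
         (auto simp: k_def z_def intro!: continuous_intros)
  qed
  also have "\<dots> = integral {- th..th} (\<lambda>ph. k ph *\<^sub>C integral {0..T} (\<lambda>x. exp (z ph * of_real (t - u x))) *\<^sub>C w' (z ph))"
    by (simp only: integral_cscale_right integral_cscale_left[OF int] cbox_interval)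
  finally have "RL_int al (\<lambda>s. arc_integral th (V.f s) N) t
      = (1 / (al * Gamma al)) *\<^sub>R integral {- th..th} (\<lambda>ph. k ph *\<^sub>C integral {0..T} (\<lambda>x. exp (z ph * of_real (t - u x))) *\<^sub>C w' (z ph))"
    by (simp add: RL_int_def mult_ac)
  also have "\<dots> = integral {- th..th} (\<lambda>ph. k ph *\<^sub>C kern (z ph) *\<^sub>C w' (z ph))"
    unfolding scaleR_cscale integral_cscale_right[symmetric]
  proof (rule integral_cong)
    fix ph
    have "z ph \<noteq> 0" using N by (simp add: z_def)
    show "of_real (1 / (al * Gamma al)) *\<^sub>C k ph *\<^sub>C integral {0..T} (\<lambda>x. exp (z ph * of_real (t - u x))) *\<^sub>C w' (z ph)
        = k ph *\<^sub>C kern (z ph) *\<^sub>C w' (z ph)"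
      unfolding kern_eq[OF \<open>z ph \<noteq> 0\<close>] T_def u_def cscale_cscale by (simp only: mult_ac)
  qed
  finally show ?thesis by (simp add: arc_integral_def k_def z_def)
qed

text \<open>The main term of \<open>kern z\<close> turns w' back into w. In the remainder |exp(z t)|
  cancels the exponential of \<open>kernel_bound\<close>, also where Re z > 0, leaving a multiple of
  1/N. With |w'| \<le> C N^(al - 1) and arc length 2 th N the result is of order N^(al - 1).\<close>

lemma arc_kern_diff_bound:
  "\<exists>K. \<forall>N>0. norm (arc_integral th (\<lambda>z. kern z *\<^sub>C w' z) N - arc_integral th (W.f t) N) \<le> K * N powr (al - 1)"
proof (intro exI allI impI)
  fix N :: real assume N: "N > 0"
  define K where "K = t powr al / Gamma al * sin th powr (al - 1) / t"
  have G: "Gamma al > 0" using al by (simp add: Gamma_real_pos)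
  have "sin th > 0" using W.th pi_gt_zero by (intro sin_gt_zero) auto
  have cont: "continuous_on (closed_sector th) (\<lambda>z. kern z *\<^sub>C w' z)" "continuous_on (closed_sector th) (W.f t)"
    by (intro continuous_intros continuous_on_kern holo_on_imp_continuous_on V.holo W.holo_f)+
  have "norm (arc_integral th (\<lambda>z. kern z *\<^sub>C w' z - W.f t z) N) \<le> 2 * th * N * (K / N * (C * N powr (al - 1)))"
  proof (rule arc_integral_norm_bound)
    show "continuous_on (closed_sector th) (\<lambda>z. kern z *\<^sub>C w' z - W.f t z)"
      by (intro continuous_intros cont)
    fix ph assume ph: "\<bar>ph\<bar> \<le> th"
    define z where "z = of_real N * cis ph"
    have z: "z \<in> closed_sector th" unfolding z_def by (rule closed_sectorI[OF N ph])
    have [simp]: "cmod z = N" using N by (simp add: z_def norm_mult)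
    have "z \<noteq> 0" using N by (simp add: z_def)
    let ?e = "exp (z * of_real t) * z powr (- of_real al)"
    have "W.f t z = ?e *\<^sub>C w' z"
      using \<open>z \<noteq> 0\<close> by (simp add: W.f_def w' cscale_cscale powr_minus field_simps)
    then have "kern z *\<^sub>C w' z - W.f t z = (- (?e * (1 - inc_gamma_kernel al t z))) *\<^sub>C w' z"
      by (simp add: kern_def algebra_simps flip: cscale.diff_left)
    then have "norm (kern z *\<^sub>C w' z - W.f t z) = cmod ?e * cmod (1 - inc_gamma_kernel al t z) * norm (w' z)"
      by (simp add: norm_cscale norm_mult)
    also have "\<dots> \<le> K / N * (C * N powr (al - 1))"
    proof (intro mult_mono)
      have e: "cmod ?e = exp (Re z * t) * N powr (- al)"
        using cmod_powr_of_real[of z "- al"] by (simp add: norm_mult)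
      have "cmod ?e * cmod (1 - inc_gamma_kernel al t z)
         \<le> cmod ?e * (t powr al / Gamma al * (cmod z * sin th) powr (al - 1) * exp (- (Re z * t)) / t)"
        by (intro mult_left_mono kernel_bound[OF al t z W.th]) auto
      also have "cmod ?e * (t powr al / Gamma al * (cmod z * sin th) powr (al - 1) * exp (- (Re z * t)) / t)
        = K * (N powr (- al) * N powr (al - 1))"
        using N \<open>sin th > 0\<close> unfolding e by (simp add: K_def powr_mult exp_minus field_simps)
      also have "N powr (- al) * N powr (al - 1) = 1 / N"
        using N by (simp add: powr_minus powr_diff divide_simps)
      finally show "cmod ?e * cmod (1 - inc_gamma_kernel al t z) \<le> K / N" by simp
      show "norm (w' z) \<le> C * N powr (al - 1)" using V.bound[OF z] by simp
      show "0 \<le> K / N" using N G t by (simp add: K_def)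
    qed auto
    finally show "norm (kern (of_real N * cis ph) *\<^sub>C w' (of_real N * cis ph) - W.f t (of_real N * cis ph)) \<le> K / N * (C * N powr (al - 1))"
      by (simp add: z_def)
  qed (use N W.th_nonneg in auto)
  then show "norm (arc_integral th (\<lambda>z. kern z *\<^sub>C w' z) N - arc_integral th (W.f t) N)
      \<le> (2 * th * (t powr al / Gamma al * sin th powr (al - 1) / t) * C) * N powr (al - 1)"
    using N by (simp add: arc_integral_diff[OF cont N] K_def)
qed

text \<open>\<open>V.F\<close> is O(s^(-al)) by \<open>F_bound\<close>, so the product with the
  weight has a Beta integrand with parameters 1 - al and al as majorant.\<close>

lemma integrable_RL_F: "(\<lambda>s. (t - s) powr (al - 1) *\<^sub>R V.F s) integrable_on {0..t}"
proof -
  obtain K where K: "K \<ge> 0" "\<And>s. s > 0 \<Longrightarrow> norm (V.F s) \<le> K * s powr (- al)"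
    using V.F_bound by auto
  show ?thesis
  proof (rule integrable_on_dominated_continuous)
    show "continuous_on {0<..<t} (\<lambda>s. (t - s) powr (al - 1) *\<^sub>R V.F s)"
      by (intro continuous_intros continuous_on_subset[OF V.continuous_on_F]) auto
    show "(\<lambda>s. K * (s powr ((1 - al) - 1) * (t - s) powr (al - 1))) integrable_on {0..t}"
      using al t by (intro integrable_on_mult_right integrable_Beta_interval) auto
    fix s assume "s \<in> {0<..<t}"
    then show "norm ((t - s) powr (al - 1) *\<^sub>R V.F s) \<le> K * (s powr ((1 - al) - 1) * (t - s) powr (al - 1))"
      using mult_left_mono[OF K(2)[of s], of "(t - s) powr (al - 1)"] by (simp add: mult_ac)
  qed
qed

text \<open>The ray tails are O(s^(-b) N^(al - b)). Decay in N asks for b > al, integrability in s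
  near 0 for b < 1.\<close>

lemma RL_F_minus_arc_bound:
  "\<exists>K. \<forall>N>0. norm (RL_int al V.F t - RL_int al (\<lambda>s. arc_integral th (V.f s) N) t) \<le> K * N powr (- ((1 - al) / 2))"
proof (intro exI allI impI)
  fix N :: real assume N: "N > 0"
  \<comment> \<open>The midpoint of al and 1; then al - b = -(1 - al)/2.\<close>
  define b where "b = (1 + al) / 2"
  have b: "0 \<le> b" "b \<le> 1" "al - 1 + 1 < b" "b < 1" using al by (simp_all add: b_def)
  have G: "Gamma al > 0" using al by (simp add: Gamma_real_pos)
  define g where "g s = s powr ((1 - b) - 1) * (t - s) powr (al - 1)" for s
  define K where "K = 2 * (C * W.c powr (- b) / (b - al)) * N powr (al - b)"
  have intg: "g integrable_on {0..t}"
    unfolding g_def using al b t by (intro integrable_Beta_interval) auto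
  have intarc: "(\<lambda>s. (t - s) powr (al - 1) *\<^sub>R arc_integral th (V.f s) N) integrable_on {0..t}"
    using has_integral_powr_substitution[OF continuous_on_subset[OF V.continuous_on_arc_integral[OF N]] al(1) t]
    by (auto intro: has_integral_integrable)
  define D where "D s = (t - s) powr (al - 1) *\<^sub>R V.F s - (t - s) powr (al - 1) *\<^sub>R arc_integral th (V.f s) N" for s
  \<comment> \<open>The tail bound holds only for s > 0. At s = 0 the majorant is 0 because
    \<open>0 powr _ = 0\<close>, so the integrand is reset to 0 there.\<close>
  define D0 where "D0 s = (if s = 0 then 0 else D s)" for s
  have "D integrable_on {0..t}"
    unfolding D_def by (intro integrable_diff integrable_RL_F intarc)
  then have D0: "D0 integrable_on {0..t}"
    by (rule integrable_spike[of D _ "{0}"]) (auto simp: D0_def)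
  have D0_eq: "integral {0..t} D0 = integral {0..t} D"
    by (rule integral_spike[of "{0}"]) (auto simp: D0_def)
  have "norm (integral {0..t} D0) \<le> integral {0..t} (\<lambda>s. K * g s)"
  proof (rule integral_norm_bound_integral[OF D0])
    show "(\<lambda>s. K * g s) integrable_on {0..t}" by (intro integrable_on_mult_right intg)
    fix s assume s: "s \<in> {0..t}"
    show "norm (D0 s) \<le> K * g s"
    proof (cases "s = 0")
      case False
      with s have "s > 0" by simp
      have "norm (V.F s - arc_integral th (V.f s) N) \<le> 2 * (C * (V.c * s) powr (- b) * N powr (al - 1 - b + 1) / (b - (al - 1) - 1))"
        by (rule V.F_minus_arc_bound[OF \<open>s > 0\<close> N b(1-3)])
      also have "al - 1 - b + 1 = al - b" by simp
      also have "b - (al - 1) - 1 = b - al" by simp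
      also have "(V.c * s) powr (- b) = W.c powr (- b) * s powr (- b)"
        by (simp only: V.c_def W.c_def powr_mult)
      finally have "norm (V.F s - arc_integral th (V.f s) N) \<le> K * s powr (- b)"
        by (simp add: K_def mult_ac)
      from mult_left_mono[OF this, of "(t - s) powr (al - 1)"] False show ?thesis
        by (simp add: D0_def D_def g_def mult_ac flip: scaleR_diff_right)
    qed (use b in \<open>simp add: D0_def g_def\<close>)
  qed
  then have "norm (integral {0..t} (\<lambda>s. (t - s) powr (al - 1) *\<^sub>R V.F s) - integral {0..t} (\<lambda>s. (t - s) powr (al - 1) *\<^sub>R arc_integral th (V.f s) N))
     \<le> K * integral {0..t} g"
    unfolding D0_eq D_def Henstock_Kurzweil_Integration.integral_diff[OF integrable_RL_F intarc] by simp
  then have "norm (RL_int al V.F t - RL_int al (\<lambda>s. arc_integral th (V.f s) N) t) \<le> 1 / Gamma al * (K * integral {0..t} g)"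
    using G unfolding RL_int_def
    by (simp add: divide_right_mono flip: scaleR_diff_right)
  also have "al - b = - ((1 - al) / 2)" by (simp add: b_def field_simps)
  then have "1 / Gamma al * (K * integral {0..t} g) = 
     (1 / Gamma al * (2 * (C * W.c powr (- b) / (b - al))) * integral {0..t} g) * N powr (- ((1 - al) / 2))"
    by (simp add: K_def)
  finally show "norm (RL_int al V.F t - RL_int al (\<lambda>s. arc_integral th (V.f s) N) t)
     \<le> (1 / Gamma al * (2 * (C * W.c powr (- ((1 + al) / 2)) / ((1 + al) / 2 - al))) *
          integral {0..t} (\<lambda>s. s powr ((1 - (1 + al) / 2) - 1) * (t - s) powr (al - 1))) * N powr (- ((1 - al) / 2))"
    unfolding b_def g_def .
qed

text \<open>The inverse Laplace form of dividing the symbol by z^al. Only arcs of finite radius are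
  integrated fractionally; both errors vanish as the radius grows.\<close>

lemma RL_int_hankel: "RL_int al V.F t = W.F t"
proof -
  let ?N = "\<lambda>n. real (Suc n)"
  have null: "(\<lambda>n. K * ?N n powr p) \<longlonglongrightarrow> 0" if "p < 0" for K p
    by (intro tendsto_mult_right_zero LIMSEQ_Suc tendsto_neg_powr[OF that filterlim_real_sequentially])
  obtain K1 where K1: "\<And>N. N > 0 \<Longrightarrow> norm (RL_int al V.F t - RL_int al (\<lambda>s. arc_integral th (V.f s) N) t) \<le> K1 * N powr (- ((1 - al) / 2))"
    using RL_F_minus_arc_bound by blast
  obtain K2 where K2: "\<And>N. N > 0 \<Longrightarrow> norm (arc_integral th (\<lambda>z. kern z *\<^sub>C w' z) N - arc_integral th (W.f t) N) \<le> K2 * N powr (al - 1)"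
    using arc_kern_diff_bound by blast
  have "(\<lambda>n. RL_int al V.F t - RL_int al (\<lambda>s. arc_integral th (V.f s) (?N n)) t) \<longlonglongrightarrow> 0"
    by (rule Lim_null_comparison[OF always_eventually null[of "- ((1 - al) / 2)" K1]]) (use K1 al in auto)
  moreover have "(\<lambda>n. arc_integral th (\<lambda>z. kern z *\<^sub>C w' z) (?N n) - arc_integral th (W.f t) (?N n)) \<longlonglongrightarrow> 0"
    by (rule Lim_null_comparison[OF always_eventually null[of "al - 1" K2]]) (use K2 al in auto)
  moreover note W.arc_integral_tendsto_F[OF t]
  \<comment> \<open>By \<open>RL_int_arc\<close> the arc terms cancel in pairs, so the sequence is
    the constant \<open>RL_int al V.F t\<close>.\<close>
  ultimately have "(\<lambda>n. (RL_int al V.F t - RL_int al (\<lambda>s. arc_integral th (V.f s) (?N n)) t)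
      + (arc_integral th (\<lambda>z. kern z *\<^sub>C w' z) (?N n) - arc_integral th (W.f t) (?N n))
      + arc_integral th (W.f t) (?N n)) \<longlonglongrightarrow> 0 + 0 + W.F t"
    by (intro tendsto_add)
  then have "(\<lambda>n. RL_int al V.F t) \<longlonglongrightarrow> W.F t"
    by (simp add: RL_int_arc del: of_nat_Suc)
  then show ?thesis by (simp add: LIMSEQ_const_iff)
qed

end

section \<open>Operations on symbols\<close>

lemma hankel_integral_cong:
  assumes "\<And>z. z \<in> closed_sector th \<Longrightarrow> f z = g z" "r > 0" "th \<ge> 0"
  shows "hankel_integral th f r = hankel_integral th g r"
proof -
  have "ray_integral ph f r = ray_integral ph g r" if "\<bar>ph\<bar> \<le> th" for ph
    unfolding ray_integral_def using assms that by (intro integral_cong) (simp add: closed_sectorI)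
  moreover have "arc_integral th f r = arc_integral th g r"
    unfolding arc_integral_def using assms by (intro integral_cong) (simp add: closed_sectorI abs_le_iff)
  ultimately show ?thesis using assms by (simp add: hankel_integral_def)
qed

text \<open>To be used with the bounded inverse of A as \<open>B\<close>, in place of an exchange of
  A itself with the contour integral.\<close>

lemma (in hankel_symbol) hankel_integral_linear:
  assumes B: "bounded_linear B" "\<And>k x. B (k *\<^sub>C x) = k *\<^sub>C B x" and s: "s > 0"
  shows "hankel_integral th (\<lambda>z. B (f s z)) (1 / s) = B (F s)"
proof -
  have "ray_integral ph (\<lambda>z. B (f s z)) (1 / s) = B (ray_integral ph (f s) (1 / s))" if "ph \<in> {th, - th}" for ph
    using integral_linear[OF ray_integrable_bound(1)[OF that s, of "1 / s" 1] B(1)] p s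
    by (simp add: ray_integral_def o_def B(2))
  moreover have "arc_integral th (\<lambda>z. B (f s z)) (1 / s) = B (arc_integral th (f s) (1 / s))"
    using integral_linear[OF integrable_continuous_interval[OF continuous_on_arc] B(1), of "1 / s" s] s
    by (simp add: arc_integral_def o_def B(2))
  ultimately show ?thesis
    by (simp add: F_def hankel_integral_def linear_add[OF bounded_linear.linear[OF B(1)]] linear_diff[OF bounded_linear.linear[OF B(1)]])
qed

text \<open>Additivity of \<open>F\<close> is read off from the arcs, whose integrals are over
  compact intervals, and passes to the limit.\<close>

lemma hankel_symbol_diff:
  assumes "hankel_symbol th p C v" "hankel_symbol th p C' w"
  shows "hankel_symbol th p (C + C') (\<lambda>z. v z - w z)"
    and "s > 0 \<Longrightarrow> hankel_symbol.F th (\<lambda>z. v z - w z) s = hankel_symbol.F th v s - hankel_symbol.F th w s"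
proof -
  interpret v: hankel_symbol th p C v by fact
  interpret w: hankel_symbol th p C' w by fact
  show 1: "hankel_symbol th p (C + C') (\<lambda>z. v z - w z)"
  proof
    fix z assume "z \<in> closed_sector th"
    from norm_triangle_le_diff[OF add_mono[OF v.bound[OF this] w.bound[OF this]]]
    show "norm (v z - w z) \<le> (C + C') * cmod z powr p" by (simp add: distrib_right)
  qed (use v.th v.p v.C w.C v.holo w.holo in \<open>auto intro: holo_on_diff\<close>)
  interpret d: hankel_symbol th p "C + C'" "\<lambda>z. v z - w z" by (rule 1)
  assume s: "s > 0"
  have "arc_integral th (d.f s) N = arc_integral th (v.f s) N - arc_integral th (w.f s) N" if "N > 0" for N
    using arc_integral_diff[OF holo_on_imp_continuous_on[OF v.holo_f[of s]] holo_on_imp_continuous_on[OF w.holo_f[of s]] that]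
    by (simp add: d.f_def[abs_def] v.f_def w.f_def cscale.diff_right)
  then have "(\<lambda>n. arc_integral th (d.f s) (real (Suc n))) \<longlonglongrightarrow> v.F s - w.F s"
    using tendsto_diff[OF v.arc_integral_tendsto_F[OF s] w.arc_integral_tendsto_F[OF s]] by (simp del: of_nat_Suc)
  from LIMSEQ_unique[OF d.arc_integral_tendsto_F[OF s] this]
  show "hankel_symbol.F th (\<lambda>z. v z - w z) s = hankel_symbol.F th v s - hankel_symbol.F th w s" .
qed

lemma holo_on_compose:
  assumes "holo_on f T" and g: "\<And>z. z \<in> S \<Longrightarrow> (g has_field_derivative g' z) (at z)"
    and g': "continuous_on S g'" and im: "\<And>z. z \<in> S \<Longrightarrow> g z \<in> T"
  shows "holo_on (\<lambda>z. f (g z)) S"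
proof -
  from assms obtain f' where f': "\<And>z. z \<in> T \<Longrightarrow> (f has_derivative (\<lambda>h. h *\<^sub>C f' z)) (at z)" "continuous_on T f'"
    unfolding holo_on_def by metis
  have "continuous_on S g" using g by (meson DERIV_isCont continuous_at_imp_continuous_on)
  then have c: "continuous_on S (\<lambda>z. f' (g z))"
    using im by (intro continuous_on_compose2[OF f'(2)]) auto
  show ?thesis
  proof (rule holo_onI[where f' = "\<lambda>z. g' z *\<^sub>C f' (g z)"])
    fix z assume z: "z \<in> S"
    from has_derivative_compose[OF g[OF z, unfolded has_field_derivative_def] f'(1)[OF im[OF z]]]
    show "((\<lambda>z. f (g z)) has_derivative (\<lambda>h. h *\<^sub>C g' z *\<^sub>C f' (g z))) (at z)"
      by (simp add: cscale_cscale mult.commute)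
  qed (intro continuous_intros g' c)
qed

section \<open>Sectors and the resolvent of a sectorial operator\<close>

lemma open_sector:
  assumes "t \<le> pi" shows "open (sector t)"
proof -
  have "sector t = - \<real>\<^sub>\<le>\<^sub>0 \<inter> Arg -` {- t<..<t}"
  proof (intro equalityI subsetI)
    fix z assume z: "z \<in> sector t"
    have "z \<notin> \<real>\<^sub>\<le>\<^sub>0"
    proof
      assume "z \<in> \<real>\<^sub>\<le>\<^sub>0"
      then have "z \<in> \<real>" "Re z \<le> 0" by (auto simp: complex_nonpos_Reals_iff complex_is_Real_iff)
      moreover from this z have "Re z < 0" by (auto simp: sector_def complex_eq_iff complex_is_Real_iff)
      ultimately have "Arg z = pi" using Arg_eq_pi[of z] by (simp add: complex_is_Real_iff)
      then show False using z assms by (simp add: sector_def)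
    qed
    then show "z \<in> - \<real>\<^sub>\<le>\<^sub>0 \<inter> Arg -` {- t<..<t}" using z by (auto simp: sector_def)
  qed (auto simp: sector_def)
  moreover have "open (- \<real>\<^sub>\<le>\<^sub>0 \<inter> Arg -` {- t<..<t})"
    by (intro continuous_open_preimage continuous_on_Arg) auto
  ultimately show ?thesis by simp
qed

text \<open>The power multiplies the argument by \<open>al\<close>, and |al ph| < pi rules out a
  jump of the principal branch. Thus even on the boundary rays of the contour z^al lies in a smaller
  sector, where the resolvent estimate is uniform.\<close>

lemma powr_closed_sector:
  assumes z: "z \<in> closed_sector th" and th: "th < pi" and al: "0 < al" "al < 1" and b: "al * th < b"
  shows "z powr of_real al \<in> sector b"
proof -
  obtain r ph where rp: "z = of_real r * cis ph" "r > 0" "\<bar>ph\<bar> \<le> th"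
    using z unfolding closed_sector_def by blast
  have "Arg z = ph" using rp th by (simp add: Arg_times_of_real Arg_cis abs_le_iff)
  have "z \<noteq> 0" using rp by auto
  then have "Im (Ln z) = ph" using \<open>Arg z = ph\<close> by (simp add: Arg_eq_Im_Ln)
  have "al * \<bar>ph\<bar> \<le> al * th" using al rp by (intro mult_left_mono) auto
  then have lt: "al * \<bar>ph\<bar> < b" using b by (rule order.strict_trans1)
  have "\<bar>ph\<bar> < pi" using rp th by simp
  have "al * \<bar>ph\<bar> \<le> \<bar>ph\<bar>" using al by (simp add: mult_left_le_one_le)
  then have pi: "\<bar>al * ph\<bar> < pi" using \<open>\<bar>ph\<bar> < pi\<close> al by (simp add: abs_mult)
  have "Arg (exp (of_real al * Ln z)) = Im (of_real al * Ln z)"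
    using pi \<open>Im (Ln z) = ph\<close> by (intro Arg_exp) auto
  then show ?thesis
    using \<open>z \<noteq> 0\<close> \<open>Im (Ln z) = ph\<close> lt al
    by (simp add: sector_def powr_def abs_mult)
qed

locale sectorial =
  fixes A :: "'a::cbanach \<Rightarrow> 'a" and D :: "'a set" and th :: real
  assumes condA: "condA A D th"
begin

abbreviation R :: "complex \<Rightarrow> 'a \<Rightarrow> 'a" where "R \<equiv> resolvent A D"

lemma th: "pi / 2 < th" "th < pi" and lin: "lin_op A D"
  using condA by (simp_all add: condA_def)

lemma A_cscale: "x \<in> D \<Longrightarrow> A (k *\<^sub>C x) = k *\<^sub>C A x"
  and D_cscale: "x \<in> D \<Longrightarrow> k *\<^sub>C x \<in> D"
  using lin by (auto simp: lin_op_def csubspace_def)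

text \<open>Justifies the definite description: a second resolvent is also a left inverse on
  \<open>D\<close>, so it reproduces every value of the first.\<close>

lemma is_resolvent_resolvent:
  assumes "l \<in> resolvent_set A D" shows "is_resolvent A D l (R l)"
proof -
  have "R1 = R2" if "is_resolvent A D l R1" "is_resolvent A D l R2" for R1 R2
  proof
    fix x
    have "R1 x \<in> D" "l *\<^sub>C R1 x - A (R1 x) = x" using that(1) by (auto simp: is_resolvent_def)
    then show "R1 x = R2 x" using that(2) unfolding is_resolvent_def by metis
  qed
  then have "\<exists>!S. is_resolvent A D l S" using assms unfolding resolvent_set_def by blast
  then show ?thesis unfolding resolvent_def by (rule theI')
qed

lemma
  assumes "l \<in> resolvent_set A D"
  shows bounded_linear_R: "bounded_linear (R l)"
    and R_in_D: "R l x \<in> D"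
    and R_right: "l *\<^sub>C R l x - A (R l x) = x"
    and R_left: "y \<in> D \<Longrightarrow> R l (l *\<^sub>C y - A y) = y"
  using is_resolvent_resolvent[OF assms] by (auto simp: is_resolvent_def)

lemma R_cscale:
  assumes "l \<in> resolvent_set A D" shows "R l (k *\<^sub>C x) = k *\<^sub>C R l x"
proof -
  have "l *\<^sub>C (k *\<^sub>C R l x) - A (k *\<^sub>C R l x) = k *\<^sub>C (l *\<^sub>C R l x - A (R l x))"
    using A_cscale[OF R_in_D[OF assms]] by (simp add: cscale_cscale mult.commute cscale.diff_right)
  also have "\<dots> = k *\<^sub>C x" by (simp add: R_right[OF assms])
  finally show ?thesis using R_left[OF assms D_cscale[OF R_in_D[OF assms]], of k x] by simp
qed

lemma A_R: "l \<in> resolvent_set A D \<Longrightarrow> A (R l x) = l *\<^sub>C R l x - x"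
  using R_right[of l x] by (simp add: algebra_simps)

lemma R_A:
  assumes "l \<in> resolvent_set A D" "y \<in> D" shows "R l (A y) = l *\<^sub>C R l y - y"
  using R_left[OF assms] linear_diff[OF bounded_linear.linear[OF bounded_linear_R[OF assms(1)]], of "l *\<^sub>C y" "A y"]
  by (simp add: R_cscale[OF assms(1)] algebra_simps)

text \<open>\<open>R l (A (R m x))\<close> is evaluated in two ways, with A absorbed by the inner or
  by the outer resolvent.\<close>

lemma resolvent_identity:
  assumes l: "l \<in> resolvent_set A D" and m: "m \<in> resolvent_set A D"
  shows "R l x - R m x = (m - l) *\<^sub>C R l (R m x)"
proof -
  interpret Rl: bounded_linear "R l" by (rule bounded_linear_R[OF l])
  have "R l (A (R m x)) = m *\<^sub>C R l (R m x) - R l x"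
    unfolding A_R[OF m] by (simp add: Rl.diff R_cscale[OF l])
  with R_A[OF l R_in_D[OF m], of x] show ?thesis
    by (simp add: cscale.diff_left algebra_simps)
qed

lemma zero_resolvent: "0 \<in> resolvent_set A D"
  using condA by (simp add: condA_def)

lemma R0_A: "y \<in> D \<Longrightarrow> R 0 (A y) = - y" and A_R0: "A (R 0 x) = - x"
  using R_A[OF zero_resolvent] A_R[OF zero_resolvent] by (simp_all add: cscale.zero_left)

lemma sector_resolvent: "b \<le> th \<Longrightarrow> l \<in> sector b \<Longrightarrow> l \<in> resolvent_set A D"
  using condA by (auto simp: condA_def sector_def)

lemma resolvent_bound:
  assumes "0 < b" "b < th"
  obtains C where "C > 0" "\<And>l x. l \<in> sector b \<Longrightarrow> norm (R l x) \<le> C / cmod l * norm x"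
proof -
  have "0 < th - b \<and> th - b < th" using assms by simp
  then obtain C where C: "C > 0" "\<And>l. l \<in> sector b \<Longrightarrow> onorm (R l) \<le> C / cmod l"
    using condA unfolding condA_def by (metis diff_diff_eq2 add_diff_cancel_left')
  have "norm (R l x) \<le> C / cmod l * norm x" if l: "l \<in> sector b" for l x
  proof -
    have "norm (R l x) \<le> onorm (R l) * norm x"
      by (rule onorm[OF bounded_linear_R[OF sector_resolvent[OF less_imp_le[OF assms(2)] l]]])
    also have "\<dots> \<le> C / cmod l * norm x" using C(2)[OF l] by (intro mult_right_mono) auto
    finally show ?thesis .
  qed
  with C(1) that show ?thesis by blast
qed

text \<open>By the resolvent identity the difference quotient at m is -R(l) R(m) a, so the
  derivative -R(m) R(m) a requires only pointwise continuity of the resolvent, which follows from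
  the same identity and the bound C/|l|.\<close>

lemma holo_on_resolvent:
  assumes b: "0 < b" "b < th"
  shows "holo_on (\<lambda>l. R l a) (sector b)"
proof -
  obtain C where C: "C > 0" "\<And>l x. l \<in> sector b \<Longrightarrow> norm (R l x) \<le> C / cmod l * norm x"
    using resolvent_bound[OF b] by blast
  note res = sector_resolvent[OF less_imp_le[OF b(2)]]
  have op: "open (sector b)" using b th by (intro open_sector) auto
  have ev: "\<forall>\<^sub>F l in at m. l \<in> sector b" if "m \<in> sector b" for m
    using op that by (intro eventually_at_in_open') 
  have cont: "((\<lambda>l. R l x) \<longlongrightarrow> R m x) (at m)" if m: "m \<in> sector b" for m x
  proof (rule LIM_zero_cancel, rule Lim_null_comparison)
    show "\<forall>\<^sub>F l in at m. norm (R l x - R m x) \<le> cmod (m - l) * (C / cmod l * norm (R m x))"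
      using ev[OF m]
    proof eventually_elim
      case (elim l)
      show ?case
        unfolding resolvent_identity[OF res[OF elim] res[OF m], of x] norm_cscale
        by (intro mult_left_mono C(2)[OF elim]) auto
    qed
    have "m \<noteq> 0" using m by (simp add: sector_def)
    then have "((\<lambda>l. cmod (m - l) * (C / cmod l * norm (R m x))) \<longlongrightarrow> cmod (m - m) * (C / cmod m * norm (R m x))) (at m)"
      by (intro tendsto_intros) auto
    then show "((\<lambda>l. cmod (m - l) * (C / cmod l * norm (R m x))) \<longlongrightarrow> 0) (at m)" by simp
  qed
  show ?thesis
  proof (rule holo_onI[where f' = "\<lambda>l. - R l (R l a)"])
    fix m assume m: "m \<in> sector b"
    show "((\<lambda>l. R l a) has_derivative (\<lambda>h. h *\<^sub>C - R m (R m a))) (at m)"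
      unfolding has_derivative_at_alt
    proof (intro conjI allI impI)
      show "bounded_linear (\<lambda>h. h *\<^sub>C - R m (R m a))" by (rule cscale.bounded_linear_left)
      fix e :: real assume "e > 0"
      have "\<forall>\<^sub>F l in at m. l \<in> sector b \<and> dist (R l (R m a)) (R m (R m a)) < e"
        using ev[OF m] tendstoD[OF cont[OF m] \<open>e > 0\<close>] by (rule eventually_conj)
      then obtain d where d: "d > 0" "\<And>l. l \<noteq> m \<Longrightarrow> dist l m < d \<Longrightarrow> l \<in> sector b \<and> dist (R l (R m a)) (R m (R m a)) < e"
        unfolding eventually_at by blast
      show "\<exists>d>0. \<forall>l. norm (l - m) < d \<longrightarrow> norm (R l a - R m a - (l - m) *\<^sub>C - R m (R m a)) \<le> e * norm (l - m)"
      proof (intro exI[of _ d] conjI allI impI)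
        fix l assume "norm (l - m) < d"
        show "norm (R l a - R m a - (l - m) *\<^sub>C - R m (R m a)) \<le> e * norm (l - m)"
        proof (cases "l = m")
          case False
          then have l: "l \<in> sector b" "norm (R l (R m a) - R m (R m a)) \<le> e"
            using d(2)[of l] \<open>norm (l - m) < d\<close> by (auto simp: dist_norm)
          have "R l a - R m a - (l - m) *\<^sub>C - R m (R m a) = (m - l) *\<^sub>C (R l (R m a) - R m (R m a))"
            unfolding resolvent_identity[OF res[OF l(1)] res[OF m], of a]
            by (simp add: cscale.diff_left cscale.diff_right cscale.minus_right)
          then have "norm (R l a - R m a - (l - m) *\<^sub>C - R m (R m a)) = norm (l - m) * norm (R l (R m a) - R m (R m a))"
            by (simp add: norm_cscale norm_minus_commute)
          also have "\<dots> \<le> norm (l - m) * e" using l(2) by (intro mult_left_mono) auto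
          finally show ?thesis by (simp add: mult.commute)
        qed (simp add: cscale.zero_left)
      qed (rule d(1))
    qed
  next
    have "((\<lambda>l. R l (R l a)) \<longlongrightarrow> R m (R m a)) (at m)" if m: "m \<in> sector b" for m
    proof -
      have "m \<noteq> 0" using m by (simp add: sector_def)
      \<comment> \<open>Operator and argument move together: R(l) R(l) a is split as R(l)(R(l) a -
        R(m) a) + R(l) R(m) a, and C/|l| stays bounded near m.\<close>
      have "((\<lambda>l. R l (R l a - R m a)) \<longlongrightarrow> 0) (at m)"
      proof (rule Lim_null_comparison)
        show "\<forall>\<^sub>F l in at m. norm (R l (R l a - R m a)) \<le> C / cmod l * norm (R l a - R m a)"
          using ev[OF m] by eventually_elim (rule C(2))
        have "((\<lambda>l. C / cmod l * norm (R l a - R m a)) \<longlongrightarrow> C / cmod m * norm (R m a - R m a)) (at m)"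
          using \<open>m \<noteq> 0\<close> by (intro tendsto_intros cont m) auto
        then show "((\<lambda>l. C / cmod l * norm (R l a - R m a)) \<longlongrightarrow> 0) (at m)" by simp
      qed
      from tendsto_add[OF this cont[OF m, of "R m a"]]
      have "((\<lambda>l. R l (R l a - R m a) + R l (R m a)) \<longlongrightarrow> R m (R m a)) (at m)" by simp
      moreover have "\<forall>\<^sub>F l in at m. R l (R l a - R m a) + R l (R m a) = R l (R l a)"
        using ev[OF m]
        by eventually_elim (simp add: linear_diff[OF bounded_linear.linear[OF bounded_linear_R[OF res]]])
      ultimately show ?thesis by (rule Lim_transform_eventually)
    qed
    then show "continuous_on (sector b) (\<lambda>l. - R l (R l a))"
      by (intro continuous_on_minus continuous_at_imp_continuous_on) (auto simp: continuous_at)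
  qed
qed

text \<open>Both \<open>A (l - A)\<^sup>-\<^sup>1\<close> and \<open>A (s - A)\<^sup>-\<^sup>1\<close> are bounded, so the integrand of the Balakrishnan
  formula is \<open>O(min (1 / s) (1 / |l|))\<close> after applying \<open>A (l - A)\<^sup>-\<^sup>1\<close>.\<close>
lemma A_resolvent_frac_bound:
  assumes b: "0 < b" "b < th" and mu: "0 < mu" "mu < 1" and a: "a \<in> frac_pow_dom A D mu"
  shows "\<exists>M\<ge>0. \<forall>l\<in>sector b. norm (A (R l a)) \<le> M * cmod l powr (- mu)"
proof -
  obtain C where C: "C > 0" "\<And>l x. l \<in> sector b \<Longrightarrow> norm (R l x) \<le> C / cmod l * norm x"
    using resolvent_bound[OF b] by blast
  note res = sector_resolvent[OF less_imp_le[OF b(2)]]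
  \<comment> \<open>The integer part of the exponent is 0, so only the Balakrishnan integral remains
    in \<open>neg_frac_pow\<close>.\<close>
  have "nat \<lfloor>mu\<rfloor> = 0" using mu by (simp add: floor_eq_iff)
  then obtain x where "a = neg_frac_pow_01 A D mu x"
    using a mu by (auto simp: frac_pow_dom_def neg_frac_pow_def Let_def)
  define h where "h s = s powr (- mu) *\<^sub>R R (of_real s) x" for s
  have a_eq: "a = (sin (pi * mu) / pi) *\<^sub>R integral {0<..} h"
    using \<open>a = _\<close> by (simp add: neg_frac_pow_01_def h_def[abs_def])
  define M where "M = C * (C + 1) * norm x"
  have M: "M \<ge> 0" using C(1) by (simp add: M_def)
  have bd: "norm (l *\<^sub>C R l y - y) \<le> (C + 1) * norm y" if l: "l \<in> sector b" for l y
  proof -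
    have "l \<noteq> 0" using l by (simp add: sector_def)
    have "norm (l *\<^sub>C R l y) \<le> cmod l * (C / cmod l * norm y)"
      unfolding norm_cscale by (intro mult_left_mono C(2)[OF l]) auto
    also have "\<dots> = C * norm y" using \<open>l \<noteq> 0\<close> by simp
    finally show ?thesis using norm_triangle_ineq4[of "l *\<^sub>C R l y" y] by (simp add: distrib_right)
  qed
  have s_sec: "of_real s \<in> sector b" if "s > 0" for s using that b by (simp add: sector_def)
  have *: "norm (A (R l a)) \<le> \<bar>sin (pi * mu) / pi\<bar> * M * (1 / (1 - mu) + 1 / mu) * cmod l powr (- mu)"
    if l: "l \<in> sector b" for l
  proof (cases "h integrable_on {0<..}")
    case True
    define L where "L = cmod l"
    have L: "L > 0" using l by (simp add: sector_def L_def)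
    \<comment> \<open>\<open>B\<close> is A (l - A)^(-1) written as a bounded operator, so it may
      pass under the integral.\<close>
    define B where "B y = l *\<^sub>C R l y - y" for y
    have B: "bounded_linear B"
      unfolding B_def
      by (intro bounded_linear_sub bounded_linear_ident
            bounded_linear_compose[OF cscale.bounded_linear_right] bounded_linear_R res l)
    interpret B: bounded_linear B by (rule B)
    \<comment> \<open>The integrand admits the bounds s^(-mu) M / L and s^(-mu) M / s. Switching at
      s = L keeps the first integrable at 0 and the second at infinity; both parts then scale like
      L^(-mu).\<close>
    define g where "g s = M * (if s \<le> L then s powr (- mu) / L else s powr (- mu - 1))" for s
    have "(g has_integral M * (L powr (- mu + 1) / (- mu + 1) / L)) {0..L}"
    proof (rule has_integral_eq)
      show "((\<lambda>s. M * (s powr (- mu) / L)) has_integral M * (L powr (- mu + 1) / (- mu + 1) / L)) {0..L}"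
        using mu L by (intro has_integral_mult_right has_integral_divide has_integral_powr_from_0) auto
    qed (simp add: g_def)
    moreover have "(g has_integral M * (- (L powr (- mu - 1 + 1)) / (- mu - 1 + 1))) {L..}"
    proof (rule has_integral_eq)
      show "((\<lambda>s. M * s powr (- mu - 1)) has_integral M * (- (L powr (- mu - 1 + 1)) / (- mu - 1 + 1))) {L..}"
        using mu L by (intro has_integral_mult_right has_integral_powr_to_inf) auto
    qed (use L in \<open>auto simp: g_def powr_diff\<close>)
    ultimately have "(g has_integral M * (L powr (- mu + 1) / (- mu + 1) / L) + M * (- (L powr (- mu - 1 + 1)) / (- mu - 1 + 1))) ({0..L} \<union> {L..})"
    proof (rule has_integral_Un)
      have "{0..L} \<inter> {L..} = {L}" using L by auto
      then show "negligible ({0..L} \<inter> {L..})" by simp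
    qed
    also have "M * (L powr (- mu + 1) / (- mu + 1) / L) + M * (- (L powr (- mu - 1 + 1)) / (- mu - 1 + 1))
        = M * (1 / (1 - mu) + 1 / mu) * L powr (- mu)"
    proof -
      have "L powr (- mu + 1) / (- mu + 1) / L = L powr (- mu) / (1 - mu)"
        using L unfolding powr_add by simp
      moreover have "- (L powr (- mu - 1 + 1)) / (- mu - 1 + 1) = L powr (- mu) / mu"
        by simp
      ultimately show ?thesis by (simp only: distrib_left distrib_right) simp
    qed
    also have "{0..L} \<union> {L..} = {0..}" using L by auto
    finally have "(g has_integral M * (1 / (1 - mu) + 1 / mu) * L powr (- mu)) {0<..}"
      by (rule has_integral_spike_set_eq[THEN iffD1, rotated 2]) (auto intro: negligible_subset[of "{0}"])
    note g = this
    have "integral {0<..} (\<lambda>s. B (h s)) = B (integral {0<..} h)" and Bh: "(\<lambda>s. B (h s)) integrable_on {0<..}"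
      using integral_linear[OF True B] integrable_linear[OF True B] by (simp_all add: o_def)
    have "norm (integral {0<..} (\<lambda>s. B (h s))) \<le> integral {0<..} g"
    proof (rule integral_norm_bound_integral[OF Bh has_integral_integrable[OF g]])
      fix s :: real assume "s \<in> {0<..}"
      then have s: "s > 0" by simp
      let ?y = "R (of_real s) x"
      \<comment> \<open>Bound 1 moves A onto \<open>?y\<close>, where A (s - A)^(-1) is bounded, and
        gains C/L from the outer resolvent; bound 2 keeps A on the outer resolvent and gains C/s
        from the inner one.\<close>
      have "B ?y = R l (A ?y)"
        by (simp add: B_def R_A[OF res[OF l] R_in_D[OF res[OF s_sec[OF s]]]])
      then have "norm (B ?y) \<le> C / L * norm (A ?y)" using C(2)[OF l] by (simp add: L_def)
      also have "\<dots> \<le> C / L * ((C + 1) * norm x)"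
        using bd[OF s_sec[OF s], of x] C(1) L by (intro mult_left_mono) (auto simp: A_R[OF res[OF s_sec[OF s]]])
      finally have 1: "norm (B ?y) \<le> M / L" by (simp add: M_def mult_ac)
      have "norm (B ?y) \<le> (C + 1) * norm ?y" unfolding B_def by (rule bd[OF l])
      also have "\<dots> \<le> (C + 1) * (C / s * norm x)"
        using C(2)[OF s_sec[OF s], of x] C(1) s by (intro mult_left_mono) auto
      finally have 2: "norm (B ?y) \<le> M / s" by (simp add: M_def mult_ac)
      have "norm (B (h s)) = s powr (- mu) * norm (B ?y)" by (simp add: h_def B.scaleR)
      also have "\<dots> \<le> g s"
        using mult_left_mono[OF 1, of "s powr (- mu)"] mult_left_mono[OF 2, of "s powr (- mu)"] s
        by (simp add: g_def powr_diff mult_ac)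
      finally show "norm (B (h s)) \<le> g s" .
    qed
    also have "integral {0<..} g = M * (1 / (1 - mu) + 1 / mu) * L powr (- mu)" using g by (rule integral_unique)
    finally have "norm (B (integral {0<..} h)) \<le> M * (1 / (1 - mu) + 1 / mu) * L powr (- mu)"
      using \<open>integral {0<..} (\<lambda>s. B (h s)) = B (integral {0<..} h)\<close> by simp
    then have "\<bar>sin (pi * mu) / pi\<bar> * norm (B (integral {0<..} h)) \<le> \<bar>sin (pi * mu) / pi\<bar> * (M * (1 / (1 - mu) + 1 / mu) * L powr (- mu))"
      by (rule mult_left_mono) simp
    moreover have "A (R l a) = (sin (pi * mu) / pi) *\<^sub>R B (integral {0<..} h)"
      by (simp only: A_R[OF res[OF l]] B_def[symmetric]) (simp only: a_eq B.scaleR)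
    ultimately show ?thesis by (simp add: L_def mult_ac)
  next
    \<comment> \<open>A non-integrable Balakrishnan integrand gives the integral its default value
      0, hence a = 0 and the estimate is trivial.\<close>
    case False
    then have "a = 0" by (simp add: a_eq not_integrable_integral)
    then have "A (R l a) = 0"
      using linear_0[OF bounded_linear.linear[OF bounded_linear_R[OF res[OF l]]]]
      using A_R[OF res[OF l], of a] \<open>a = 0\<close> by (simp add: cscale.zero_right)
    then show ?thesis using M mu by simp
  qed
  show ?thesis
    by (intro exI[of _ "\<bar>sin (pi * mu) / pi\<bar> * M * (1 / (1 - mu) + 1 / mu)"] conjI ballI *)
       (use M mu in auto)
qed

end

section \<open>L^q membership, and the symbols of G(t)a - a and A G(t)a\<close>

text \<open>The q-th power is dominated by a multiple of t^(-q e), integrable at 0 because q e <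
  1.\<close>

lemma Lq_powr_bound:
  fixes v :: "real \<Rightarrow> 'a::cbanach"
  assumes v: "continuous_on {0<..<T} v" and T: "T > 0" and q: "1 \<le> q" and qe: "q * e < 1"
    and K: "K \<ge> 0" "\<And>t. t \<in> {0<..<T} \<Longrightarrow> norm (v t) \<le> K * t powr (- e)"
  shows "v \<in> Lq (ereal q) {0<..<T}"
proof -
  have I: "((\<lambda>t. K powr q * t powr (- (q * e))) has_integral K powr q * (T powr (- (q * e) + 1) / (- (q * e) + 1))) {0..T}"
    using qe T by (intro has_integral_mult_right has_integral_powr_from_0) auto
  have "(\<integral>\<^sup>+ t. indicator {0<..<T} t * ennreal (norm (v t) powr q) \<partial>lebesgue)
      \<le> (\<integral>\<^sup>+ t. ennreal (indicator {0..T} t * (K powr q * t powr (- (q * e)))) \<partial>lebesgue)"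
  proof (rule nn_integral_mono)
    fix t
    show "indicator {0<..<T} t * ennreal (norm (v t) powr q) \<le> ennreal (indicator {0..T} t * (K powr q * t powr (- (q * e))))"
    proof (cases "t \<in> {0<..<T}")
      case True
      have "norm (v t) powr q \<le> (K * t powr (- e)) powr q" using K(2)[OF True] q by (intro powr_mono2) auto
      also have "\<dots> = K powr q * t powr (- (q * e))" by (simp add: powr_mult powr_powr mult.commute)
      finally show ?thesis using True by (simp add: ennreal_leI)
    qed simp
  qed
  also have "\<dots> = ennreal (K powr q * (T powr (- (q * e) + 1) / (- (q * e) + 1)))"
    unfolding nn_integral_completion by (rule nn_integral_has_integral_lebesgue[OF _ I]) simp
  also have "\<dots> < \<infinity>" by simp
  finally show ?thesis
    using strongly_measurable_on_continuous[OF _ v] by (simp add: Lq_def)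
qed

lemma Lq_infinity_bound:
  assumes "continuous_on S v" "open S" "\<And>t. t \<in> S \<Longrightarrow> norm (v t) \<le> K"
  shows "v \<in> Lq \<infinity> S"
  using assms strongly_measurable_on_continuous[OF assms(2,1)] by (auto simp: Lq_def)

lemma Gop_eq_hankel_integral:
  "Gop A D al th t a = (1 / (2 * complex_of_real pi * \<i>)) *\<^sub>C hankel_integral th (G_integrand A D al t a) (1 / t)"
  by (simp add: Gop_def hankel_integral_def ray_integral_def arc_integral_def)

theorem theorem2p1:
  fixes A :: "'a::cbanach \<Rightarrow> 'a" and D :: "'a set"
    and al mu th :: real and q :: ereal and a :: 'a
  assumes "condA A D th"
    and "0 < al" and "al < 1"
    and "1 \<le> q"
    and "ereal 1 - 1 / (q * ereal al) < ereal mu" and "mu < 1"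
    and "a \<in> frac_pow_dom A D mu"
  shows "\<forall>T>0. (\<lambda>t. Gop A D al th t a - a) \<in> W_space al q T
            \<and> (\<lambda>t. Gop A D al th t a - a) \<in> Lq \<infinity> {0<..}
            \<and> (\<forall>t\<in>{0<..<T}. Gop A D al th t a \<in> D)
            \<and> has_frac_deriv al q T (\<lambda>t. Gop A D al th t a - a) (\<lambda>t. A (Gop A D al th t a))"
proof -
  note al = \<open>0 < al\<close> \<open>al < 1\<close>
  interpret sectorial A D th by standard fact
  \<comment> \<open>Any angle strictly between al th and th would do: the powers z^al lie inside the
    sector of angle \<open>b\<close>, and Condition (A) is uniform on it.\<close>
  define b where "b = (th + al * th) / 2"
  have "th > 0" using th pi_gt_zero by linarith
  then have "al * th < th" "0 < al * th" using al by simp_all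
  with \<open>th > 0\<close> have b: "0 < b" "b < th" "al * th < b"
    by (simp_all add: b_def)
  have powr_b: "z powr of_real al \<in> sector b" if "z \<in> closed_sector th" for z
    by (rule powr_closed_sector[OF that th(2) al b(3)])
  note res = sector_resolvent[OF less_imp_le[OF b(2)]]
  obtain C where C: "C > 0" "\<And>l x. l \<in> sector b \<Longrightarrow> norm (R l x) \<le> C / cmod l * norm x"
    using resolvent_bound[OF b(1,2)] by blast
  define ic where "ic = 1 / (2 * complex_of_real pi * \<i>)"

  \<comment> \<open>\<open>wG\<close> is the symbol of G(t)a and \<open>wI\<close> that of the
    constant a. As z^al R(z^al) - 1 = A R(z^al), their difference is z^(-1) A R(z^al) a.\<close>
  define wG where "wG z = z powr (of_real al - 1) *\<^sub>C R (z powr of_real al) a" for z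
  define wI where "wI z = inverse z *\<^sub>C a" for z
  define w where "w = (\<lambda>z. wG z - wI z)"
  define w' where "w' = (\<lambda>z. z powr of_real al *\<^sub>C w z)"
  have pd: "((\<lambda>z. z powr of_real s) has_field_derivative of_real s * z powr (of_real s - 1)) (at z)"
    if "z \<in> closed_sector th" for z s
    by (intro has_field_derivative_powr closed_sector_nonpos_Reals[OF that th(2)])
  have "closed_sector th \<subseteq> - \<real>\<^sub>\<le>\<^sub>0" using closed_sector_nonpos_Reals[OF _ th(2)] by auto
  then have pc: "continuous_on (closed_sector th) (\<lambda>z. of_real k * z powr s)" for k s
    by (intro continuous_intros) (auto simp: complex_nonpos_Reals_iff subset_iff not_le)
  have symG: "hankel_symbol th (- 1) (C * norm a) wG"
  proof
    have "holo_on (\<lambda>z. R (z powr of_real al) a) (closed_sector th)"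
      by (rule holo_on_compose[OF holo_on_resolvent[OF b(1,2)] pd pc powr_b])
    from holo_on_cscale[OF this pd[of _ "al - 1"] pc]
    show "holo_on wG (closed_sector th)" by (simp add: wG_def[abs_def])
    fix z assume z: "z \<in> closed_sector th"
    have "z \<noteq> 0" using closed_sector_nonpos_Reals[OF z th(2)] by auto
    have "norm (wG z) = cmod z powr (al - 1) * norm (R (z powr of_real al) a)"
      using cmod_powr_of_real[of z "al - 1"] by (simp add: wG_def norm_cscale)
    also have "\<dots> \<le> cmod z powr (al - 1) * (C / cmod z powr al * norm a)"
      using C(2)[OF powr_b[OF z], of a] by (intro mult_left_mono) (simp_all add: cmod_powr_of_real)
    also have "\<dots> = C * norm a * cmod z powr (- 1)"
      using \<open>z \<noteq> 0\<close> by (simp add: powr_diff powr_minus divide_simps)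
    finally show "norm (wG z) \<le> C * norm a * cmod z powr (- 1)" .
  qed (use th C in auto)
  have symI: "hankel_symbol th (- 1) (norm a) wI"
    unfolding wI_def by (rule hankel_symbol_inverse[OF th])
  have symW: "hankel_symbol th (- 1) (C * norm a + norm a) w"
    unfolding w_def by (rule hankel_symbol_diff(1)[OF symG symI])
  have symV: "hankel_symbol th (al - 1) (C * norm a + norm a) w'"
    using hankel_symbol_powr[OF symW, of al] al by (simp add: w'_def)
  interpret G: hankel_symbol th "- 1" "C * norm a" wG by (rule symG)
  interpret W: hankel_symbol th "- 1" "C * norm a + norm a" w by (rule symW)
  interpret V: hankel_symbol th "al - 1" "C * norm a + norm a" w' by (rule symV)

  have w'_eq: "w' z = z powr (of_real al - 1) *\<^sub>C A (R (z powr of_real al) a)" if z: "z \<in> closed_sector th" for z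
  proof -
    have "z \<noteq> 0" using closed_sector_nonpos_Reals[OF z th(2)] by auto
    then have "z powr of_real al * inverse z = z powr (of_real al - 1)" by (simp add: powr_diff divide_inverse)
    then show ?thesis
      by (simp add: w'_def w_def wG_def wI_def A_R[OF res[OF powr_b[OF z]]] cscale.diff_right cscale_cscale mult.commute)
  qed

  define v where "v t = ic *\<^sub>C V.F t" for t
  have Gop_F: "Gop A D al th t a = ic *\<^sub>C G.F t" for t
  proof -
    have "G_integrand A D al t a = G.f t"
      by (simp add: fun_eq_iff G_integrand_def G.f_def wG_def cscale_cscale)
    then show ?thesis by (simp add: Gop_eq_hankel_integral G.F_def ic_def)
  qed
  have Gop_a: "Gop A D al th t a - a = ic *\<^sub>C W.F t" if t: "t > 0" for t
  proof -
    have "W.F t = G.F t - (2 * of_real pi * \<i>) *\<^sub>C a"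
      using hankel_symbol_diff(2)[OF symG symI t] hankel_exp_over[OF th t, of a]
      by (simp add: w_def wI_def[abs_def])
    then show ?thesis
      by (simp add: Gop_F cscale.diff_right cscale_cscale ic_def cscale_one)
  qed
  have RL: "Gop A D al th t a - a = RL_int al v t" if t: "t > 0" for t
  proof -
    have "RL_int al v t = ic *\<^sub>C RL_int al V.F t"
      by (simp add: RL_int_def v_def cscale.scaleR_right integral_cscale_right flip: cscale.scaleR_right)
    also have "\<dots> = ic *\<^sub>C W.F t" using RL_int_hankel[OF symW al t w'_def] by simp
    finally show ?thesis using Gop_a[OF t] by simp
  qed
  \<comment> \<open>-R(0) is the inverse of A. It turns \<open>w'\<close> into \<open>wG\<close>
    pointwise on the sector, and being bounded it commutes with the contour integral.\<close>
  have Gop_R0: "Gop A D al th t a = - R 0 (v t)" if t: "t > 0" for t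
  proof -
    have "hankel_integral th (\<lambda>z. - R 0 (V.f t z)) (1 / t) = - R 0 (V.F t)"
      by (rule V.hankel_integral_linear[OF bounded_linear_minus[OF bounded_linear_R[OF zero_resolvent]] _ t])
         (simp add: R_cscale[OF zero_resolvent] cscale.minus_right)
    moreover have "hankel_integral th (\<lambda>z. - R 0 (V.f t z)) (1 / t) = hankel_integral th (G.f t) (1 / t)"
    proof (rule hankel_integral_cong)
      fix z assume z: "z \<in> closed_sector th"
      show "- R 0 (V.f t z) = G.f t z"
        by (simp add: V.f_def G.f_def w'_eq[OF z] wG_def R_cscale[OF zero_resolvent]
            R0_A[OF R_in_D[OF res[OF powr_b[OF z]]]] cscale.minus_right)
    qed (use t \<open>th > 0\<close> in auto)
    ultimately have "G.F t = - R 0 (V.F t)" by (simp add: G.F_def)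
    then show ?thesis by (simp add: Gop_F v_def R_cscale[OF zero_resolvent] cscale.minus_right)
  qed
  have Gop_D: "Gop A D al th t a \<in> D" and A_Gop: "A (Gop A D al th t a) = v t" if t: "t > 0" for t
  proof -
    have "R 0 (- v t) = - R 0 (v t)"
      using linear_neg[OF bounded_linear.linear[OF bounded_linear_R[OF zero_resolvent]]] .
    then have eq: "Gop A D al th t a = R 0 (- v t)" using Gop_R0[OF t] by simp
    show "Gop A D al th t a \<in> D" unfolding eq by (rule R_in_D[OF zero_resolvent])
    show "A (Gop A D al th t a) = v t" unfolding eq A_R0 by simp
  qed

  \<comment> \<open>For \<open>mu \<le> 0\<close> the vector a is arbitrary, and the basic decay
    exponent al - 1 of \<open>w'\<close> already gives the case m = 0.\<close>
  define m where "m = max mu 0"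
  have m: "0 \<le> m" "m < 1" using \<open>mu < 1\<close> by (auto simp: m_def)
  obtain K where K: "K \<ge> 0" "\<And>t. t > 0 \<Longrightarrow> norm (V.F t) \<le> K * t powr (- (al * (1 - m)))"
  proof (cases "mu > 0")
    case True
    then have [simp]: "m = mu" by (simp add: m_def)
    obtain M where M: "M \<ge> 0" "\<And>l. l \<in> sector b \<Longrightarrow> norm (A (R l a)) \<le> M * cmod l powr (- mu)"
      using A_resolvent_frac_bound[OF b(1,2) True \<open>mu < 1\<close> \<open>a \<in> frac_pow_dom A D mu\<close>] by blast
    \<comment> \<open>The same symbol with a better decay exponent. \<open>F\<close> depends only on
      the angle and the symbol, so the sharper bound of \<open>F_bound\<close> applies to
      \<open>V.F\<close> itself.\<close>
    interpret V': hankel_symbol th "al * (1 - mu) - 1" M w'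
    proof
      fix z assume z: "z \<in> closed_sector th"
      have "norm (w' z) = cmod z powr (al - 1) * norm (A (R (z powr of_real al) a))"
        using cmod_powr_of_real[of z "al - 1"] by (simp add: w'_eq[OF z] norm_cscale)
      also have "\<dots> \<le> cmod z powr (al - 1) * (M * cmod z powr (- (al * mu)))"
        using M(2)[OF powr_b[OF z]] by (intro mult_left_mono) (simp_all add: cmod_powr_of_real powr_powr)
      also have "\<dots> = M * cmod z powr (al * (1 - mu) - 1)"
        by (simp add: algebra_simps flip: powr_add)
      finally show "norm (w' z) \<le> M * cmod z powr (al * (1 - mu) - 1)" .
    next
      have "al * (1 - mu) < 1 * 1" using al True \<open>mu < 1\<close> by (intro mult_strict_mono) auto
      then show "al * (1 - mu) - 1 < 0" by simp
    qed (use th M V.holo in auto)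
    show thesis using V'.F_bound that by auto
  next
    case False
    then show thesis using V.F_bound that by (auto simp: m_def)
  qed
  have v_bound: "norm (v t) \<le> cmod ic * K * t powr (- (al * (1 - m)))" if "t > 0" for t
    using mult_left_mono[OF K(2)[OF that], of "cmod ic"] by (simp add: v_def norm_cscale mult_ac)
  have v_cont: "continuous_on {0<..} v"
    unfolding v_def by (intro continuous_intros V.continuous_on_F)

  \<comment> \<open>For infinite q the lower bound on \<open>mu\<close> would read 1 < mu, against
    \<open>mu < 1\<close>.\<close>
  have "q \<noteq> \<infinity>" using assms(5,6) al by auto
  then obtain p where q: "q = ereal p" "1 \<le> p" using \<open>1 \<le> q\<close> by (cases q) auto
  have "1 - 1 / (p * al) < mu" using assms(5) q al by (simp add: one_ereal_def)
  \<comment> \<open>This is the lower bound on \<open>mu\<close>, transferred to m \<ge> mu;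
    multiplied by p al it is the integrability condition at 0.\<close>
  then have "1 - m < 1 / (p * al)" by (simp add: m_def)
  then have pe: "p * (al * (1 - m)) < 1" using q al by (simp add: field_simps)

  have Lq_AG: "(\<lambda>t. A (Gop A D al th t a)) \<in> Lq q {0<..<T}" if "T > 0" for T
    unfolding q(1)
  proof (rule Lq_powr_bound[OF _ that q(2) pe, where K = "cmod ic * K"])
    show "continuous_on {0<..<T} (\<lambda>t. A (Gop A D al th t a))"
      by (rule continuous_on_eq[OF continuous_on_subset[OF v_cont]]) (auto simp: A_Gop)
  qed (use K v_bound in \<open>auto simp: A_Gop\<close>)
  have deriv: "has_frac_deriv al q T (\<lambda>t. Gop A D al th t a - a) (\<lambda>t. A (Gop A D al th t a))" if "T > 0" for T
  proof -
    have "Gop A D al th t a - a = RL_int al (\<lambda>t. A (Gop A D al th t a)) t" if "t > 0" for t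
    proof -
      \<comment> \<open>The two integrands are known to agree only for positive times; the point 0
        is negligible.\<close>
      have "RL_int al (\<lambda>t. A (Gop A D al th t a)) t = RL_int al v t"
        unfolding RL_int_def
        by (intro arg_cong[where f = "(*\<^sub>R) _"] integral_spike[of "{0}"]) (auto simp: A_Gop)
      then show ?thesis using RL[OF that] by simp
    qed
    then show ?thesis using Lq_AG[OF that] by (auto simp: has_frac_deriv_def)
  qed
  have bounded: "(\<lambda>t. Gop A D al th t a - a) \<in> Lq \<infinity> {0<..}"
  proof -
    \<comment> \<open>For \<open>w\<close> the decay exponent is -1, so the power in
      \<open>F_bound\<close> is t^0 and the bound is uniform on the half-line.\<close>
    obtain K' where K': "\<And>t. t > 0 \<Longrightarrow> norm (W.F t) \<le> K' * t powr 0"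
      using W.F_bound by auto
    show ?thesis
    proof (rule Lq_infinity_bound)
      have "continuous_on {0<..} (\<lambda>t. ic *\<^sub>C W.F t)"
        by (intro continuous_intros W.continuous_on_F)
      then show "continuous_on {0<..} (\<lambda>t. Gop A D al th t a - a)"
        by (rule continuous_on_eq) (simp add: Gop_a)
      fix t :: real assume "t \<in> {0<..}"
      then have t: "t > 0" by simp
      then show "norm (Gop A D al th t a - a) \<le> cmod ic * K'"
        using mult_left_mono[OF K'[OF t], of "cmod ic"] by (simp add: Gop_a norm_cscale)
    qed simp
  qed
  show ?thesis
    using deriv bounded Gop_D unfolding W_space_def by auto
qed

end
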